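(* Let $T\in\mathbb{N}$, $L>0$, and let $\eta_1,\dots,\eta_T>0$, $\sigma_1,\dots,\sigma_T>0$. For $d\in\mathbb{N}$, consider a noisy iterative algorithm in $\mathbb{R}^d$ with update rule $W_t=g(W_{t-1})-\eta_tF(W_{t-1},Z_t)+\xi_t$, $1\le t\le T$, as described in the context, with final output $W$ (a function of $W^T=(W_1,\dots,W_T)$). Suppose that $P(Z_{t+1}\mid Z^t,W^t,S)=P(Z_{t+1}\mid Z^t,S)$ for all $t$, that $\sup_{w,z}\|F(w,z)\|_1\le L$, and that for every $t$ the noise $\xi_t$ is composed of i.i.d. components, each distributed as $\mathrm{Lap}\big(0,\frac{\sigma_t}{\sqrt2}\big)$. Then $$\mathcal{L}(S\to W)\le\sum_{t=1}^T\log\left(\frac{V_1(d,\eta_tL)}{(\sigma_t\sqrt2)^d}+\sum_{i=0}^{d-1}\frac{(\sqrt2\,\eta_tL/\sigma_t)^i}{i!}\right),$$ where $V_1(d,r)=\dfrac{(2r)^d}{d!}$. Consequently, for fixed $T$ (and fixed $L$, $\eta_t$, $\sigma_t$), for any sequence of such algorithms indexed by the dimension $d$, $$\limsup_{d\to\infty}\mathcal{L}(S\to W)\le\sum_{t=1}^T\frac{\sqrt2\,\eta_tL}{\sigma_t}.$$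
   Context: $\mathrm{Lap}(\mu,1/\lambda)$, for $\mu\in\mathbb{R}$, $\lambda>0$, denotes the distribution on $\mathbb{R}$ with density $\frac\lambda2e^{-\lambda|x-\mu|}$ (variance $2/\lambda^2$). Maximal leakage: for random variables $X,Y$ with joint law $P_{XY}$, $\mathcal{L}(X\to Y)=I_\infty(X,Y)=\min_{Q_Y}D_\infty(P_{XY}\|P_XQ_Y)=\log\mathbb{E}_{P_Y}\big[\operatorname{ess\,sup}_{P_X}\frac{dP_{XY}}{d(P_XP_Y)}\big]$, where $D_\infty$ is the Rényi divergence of order $\infty$. If $X,Y$ are jointly continuous this equals $\log\int\operatorname{ess\,sup}_{P_X}f_{Y|X}(y|x)\,dy$. Logarithms are natural. Setup: $S=(Z'_1,\dots,Z'_n)$ is a data set of $n$ i.i.d. samples from an unknown distribution on a sample space $\mathcal{Z}$. The algorithm generates $W_t=g(W_{t-1})-\eta_tF(W_{t-1},Z_t)+\xi_t$ for $t=1,\dots,T$, where $Z_t\subseteq S$ is a (possibly random) subset (mini-batch) of the data sampled according to some distribution, $g:\mathbb{R}^d\to\mathbb{R}^d$ is a deterministic function, $F(w,z)\in\mathbb{R}^d$ is a direction (e.g. a gradient), $\eta_t$ is the step-size, and $\xi_t$ is an $\mathbb{R}^d$-valued noise with an absolutely continuous distribution. The initial point $W_0$ is independent of $(S,Z_1,\dots,Z_T)$, and the noises $\xi_1,\dots,\xi_T$ are mutually independent and independent of $(W_0,S,Z_1,\dots,Z_T)$; thus $P(W_{t+1}\mid W^t,Z^T,S)=P(W_{t+1}\mid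 W_t,Z_{t+1})$. Notation: $W^t=(W_1,\dots,W_t)$, $Z^t=(Z_1,\dots,Z_t)$, $\|x\|_1=\sum_i|x_i|$. *)

theory Defs
  imports "HOL-Probability.Probability" "HOL-Library.Multiset"
begin

section \<open>Maximal leakage\<close>

definition ln_ennreal :: "ennreal \<Rightarrow> ereal" where
  "ln_ennreal x = (if x = 0 then -\<infinity> else if x = \<infinity> then \<infinity> else ereal (ln (enn2real x)))"

text \<open>The Renyi divergence of order infinity of \<open>P\<close> from \<open>Q\<close>. The value is infinite
  without absolute continuity; the case distinction is needed because \<open>RN_deriv\<close> is then
  meaningless. The order of arguments in \<open>absolutely_continuous Q P\<close> and \<open>RN_deriv Q P\<close>
  is that of the library: \<open>P\<close> is absolutely continuous with respect to \<open>Q\<close>, and the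
  derivative is \<open>dP/dQ\<close>.\<close>

definition renyi_div_inf :: "'a measure \<Rightarrow> 'a measure \<Rightarrow> ereal" where
  "renyi_div_inf P Q =
     (if sets P = sets Q \<and> absolutely_continuous Q P
      then ln_ennreal (esssup P (RN_deriv Q P)) else \<infinity>)"

text \<open>Maximal leakage from \<open>X\<close> to \<open>Y\<close>: the smallest divergence of the joint law from a product
  of the law of \<open>X\<close> with an arbitrary law \<open>Q\<close> for \<open>Y\<close>.\<close>

definition max_leakage ::
  "'w measure \<Rightarrow> 'x measure \<Rightarrow> ('w \<Rightarrow> 'x) \<Rightarrow> 'y measure \<Rightarrow> ('w \<Rightarrow> 'y) \<Rightarrow> ereal" where
  "max_leakage M A X B Y =
     (INF Q \<in> {Q. prob_space Q \<and> sets Q = sets B}.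
        renyi_div_inf (distr M (A \<Otimes>\<^sub>M B) (\<lambda>\<omega>. (X \<omega>, Y \<omega>))) (distr M A X \<Otimes>\<^sub>M Q))"

section \<open>Euclidean space of variable dimension, Laplace law, independence\<close>

text \<open>The dimension tends to infinity in the theorem, so it cannot be a type: a point of
  \<open>d\<close>-dimensional space is an extensional function on \<open>{..<d}\<close>.\<close>

abbreviation Rd :: "nat \<Rightarrow> (nat \<Rightarrow> real) measure" where
  "Rd d \<equiv> PiM {..<d} (\<lambda>_. borel)"

definition norm1 :: "nat \<Rightarrow> (nat \<Rightarrow> real) \<Rightarrow> real" where
  "norm1 d x = (\<Sum>i<d. \<bar>x i\<bar>)"

definition V1 :: "nat \<Rightarrow> real \<Rightarrow> real" where
  "V1 d r = (2 * r) ^ d / fact d"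

text \<open>Density of \<open>Lap(m, b)\<close>; the second parameter is the scale \<open>b = 1 / \<lambda>\<close>.\<close>

definition laplace_density :: "real \<Rightarrow> real \<Rightarrow> real \<Rightarrow> real" where
  "laplace_density m b x = (1 / b) / 2 * exp (- (1 / b) * \<bar>x - m\<bar>)"

text \<open>The library's \<open>indep_var\<close> requires both variables to have the same value type.\<close>

definition indep_rvs ::
  "'w measure \<Rightarrow> 'x measure \<Rightarrow> ('w \<Rightarrow> 'x) \<Rightarrow> 'y measure \<Rightarrow> ('w \<Rightarrow> 'y) \<Rightarrow> bool" where
  "indep_rvs M A X B Y \<longleftrightarrow>
     X \<in> measurable M A \<and> Y \<in> measurable M B \<and>
     prob_space.indep_set M {X -` C \<inter> space M | C. C \<in> sets A} {Y -` C \<inter> space M | C. C \<in> sets B}"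

section \<open>Noisy iterative algorithms\<close>

text \<open>The data set is a family \<open>sample i\<close>, \<open>i < nsamples\<close>. A mini-batch is a sub-multiset of the
  data set, so that equal samples are not merged; the sigma-algebra \<open>batch_space\<close> on batches
  is arbitrary. \<open>iterate 0\<close> is the initial point \<open>W\<^sub>0\<close>; \<open>batch t\<close>, \<open>noise t\<close> and
  \<open>iterate t\<close> are used for \<open>1 \<le> t \<le> T\<close>. \<open>out_fun\<close> computes the final output from the
  trajectory \<open>(W\<^sub>1, ..., W\<^sub>T)\<close>.\<close>

record ('w, 'z, 'o) noisy_alg =
  prob_of :: "'w measure"
  nsamples :: nat
  sample_space :: "'z measure"
  sample :: "nat \<Rightarrow> 'w \<Rightarrow> 'z"
  batch_space :: "'z multiset measure"
  batch :: "nat \<Rightarrow> 'w \<Rightarrow> 'z multiset"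
  drift :: "(nat \<Rightarrow> real) \<Rightarrow> (nat \<Rightarrow> real)"
  direction :: "(nat \<Rightarrow> real) \<Rightarrow> 'z multiset \<Rightarrow> (nat \<Rightarrow> real)"
  noise :: "nat \<Rightarrow> 'w \<Rightarrow> (nat \<Rightarrow> real)"
  iterate :: "nat \<Rightarrow> 'w \<Rightarrow> (nat \<Rightarrow> real)"
  out_space :: "'o measure"
  out_fun :: "(nat \<Rightarrow> nat \<Rightarrow> real) \<Rightarrow> 'o"

definition data_space :: "('w, 'z, 'o) noisy_alg \<Rightarrow> (nat \<Rightarrow> 'z) measure" where
  "data_space A = PiM {..<nsamples A} (\<lambda>_. sample_space A)"

definition data :: "('w, 'z, 'o) noisy_alg \<Rightarrow> 'w \<Rightarrow> (nat \<Rightarrow> 'z)" where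
  "data A \<omega> = (\<lambda>i\<in>{..<nsamples A}. sample A i \<omega>)"

text \<open>The histories \<open>Z\<^sup>t\<close>, \<open>W\<^sup>t\<close> and \<open>\<xi>\<^sup>t\<close>, with times \<open>1, ..., t\<close>.\<close>

definition batches :: "('w, 'z, 'o) noisy_alg \<Rightarrow> nat \<Rightarrow> 'w \<Rightarrow> (nat \<Rightarrow> 'z multiset)" where
  "batches A t \<omega> = (\<lambda>s\<in>{1..t}. batch A s \<omega>)"

definition iterates :: "('w, 'z, 'o) noisy_alg \<Rightarrow> nat \<Rightarrow> 'w \<Rightarrow> (nat \<Rightarrow> nat \<Rightarrow> real)" where
  "iterates A t \<omega> = (\<lambda>s\<in>{1..t}. iterate A s \<omega>)"

definition noises :: "('w, 'z, 'o) noisy_alg \<Rightarrow> nat \<Rightarrow> 'w \<Rightarrow> (nat \<Rightarrow> nat \<Rightarrow> real)" where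
  "noises A t \<omega> = (\<lambda>s\<in>{1..t}. noise A s \<omega>)"

abbreviation batches_space :: "('w, 'z, 'o) noisy_alg \<Rightarrow> nat \<Rightarrow> (nat \<Rightarrow> 'z multiset) measure" where
  "batches_space A t \<equiv> PiM {1..t} (\<lambda>_. batch_space A)"

abbreviation traj_space :: "nat \<Rightarrow> nat \<Rightarrow> (nat \<Rightarrow> nat \<Rightarrow> real) measure" where
  "traj_space d t \<equiv> PiM {1..t} (\<lambda>_. Rd d)"

definition final_output :: "('w, 'z, 'o) noisy_alg \<Rightarrow> nat \<Rightarrow> 'w \<Rightarrow> 'o" where
  "final_output A T \<omega> = out_fun A (iterates A T \<omega>)"

definition iid_data :: "('w, 'z, 'o) noisy_alg \<Rightarrow> bool" where
  "iid_data A \<longleftrightarrow>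
     prob_space (sample_space A) \<and>
     prob_space.indep_vars (prob_of A) (\<lambda>_. sample_space A) (sample A) {..<nsamples A} \<and>
     (\<forall>i<nsamples A. distr (prob_of A) (sample_space A) (sample A i) = sample_space A)"

definition noisy_iterative ::
  "nat \<Rightarrow> nat \<Rightarrow> (nat \<Rightarrow> real) \<Rightarrow> ('w, 'z, 'o) noisy_alg \<Rightarrow> bool" where
  "noisy_iterative d T \<eta> A \<longleftrightarrow>
     prob_space (prob_of A) \<and>
     iid_data A \<and>
     (\<forall>t\<in>{1..T}. batch A t \<in> measurable (prob_of A) (batch_space A)) \<and>
     (\<forall>t\<in>{1..T}. \<forall>\<omega>\<in>space (prob_of A).
        batch A t \<omega> \<subseteq># image_mset (\<lambda>i. sample A i \<omega>) (mset_set {..<nsamples A})) \<and>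
     drift A \<in> measurable (Rd d) (Rd d) \<and>
     (\<lambda>(w, z). direction A w z) \<in> measurable (Rd d \<Otimes>\<^sub>M batch_space A) (Rd d) \<and>
     out_fun A \<in> measurable (traj_space d T) (out_space A) \<and>
     (\<forall>t\<in>{1..T}. absolutely_continuous (PiM {..<d} (\<lambda>_. lborel))
        (distr (prob_of A) (Rd d) (noise A t))) \<and>
     indep_rvs (prob_of A) (Rd d) (iterate A 0)
        (data_space A \<Otimes>\<^sub>M batches_space A T) (\<lambda>\<omega>. (data A \<omega>, batches A T \<omega>)) \<and>
     prob_space.indep_vars (prob_of A) (\<lambda>_. Rd d) (noise A) {1..T} \<and>
     indep_rvs (prob_of A) (traj_space d T) (noises A T)
        (Rd d \<Otimes>\<^sub>M data_space A \<Otimes>\<^sub>M batches_space A T)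
        (\<lambda>\<omega>. (iterate A 0 \<omega>, data A \<omega>, batches A T \<omega>)) \<and>
     (\<forall>t\<in>{1..T}. \<forall>\<omega>\<in>space (prob_of A).
        iterate A t \<omega> = (\<lambda>i\<in>{..<d}.
          drift A (iterate A (t - 1) \<omega>) i
          - \<eta> t * direction A (iterate A (t - 1) \<omega>) (batch A t \<omega>) i
          + noise A t \<omega> i))"

text \<open>\<open>P(Z\<^sub>t\<^sub>+\<^sub>1 | Z\<^sup>t, W\<^sup>t, S) = P(Z\<^sub>t\<^sub>+\<^sub>1 | Z\<^sup>t, S)\<close>, as almost sure equality of the conditional
  probabilities of every event about \<open>Z\<^sub>t\<^sub>+\<^sub>1\<close>.\<close>

definition nonadaptive_sampling :: "nat \<Rightarrow> nat \<Rightarrow> ('w, 'z, 'o) noisy_alg \<Rightarrow> bool" where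
  "nonadaptive_sampling d T A \<longleftrightarrow>
     (\<forall>t<T. \<forall>C\<in>sets (batch_space A). AE \<omega> in prob_of A.
        real_cond_exp (prob_of A)
          (vimage_algebra (space (prob_of A))
             (\<lambda>\<omega>. (batches A t \<omega>, iterates A t \<omega>, data A \<omega>))
             (batches_space A t \<Otimes>\<^sub>M traj_space d t \<Otimes>\<^sub>M data_space A))
          (\<lambda>\<omega>. indicator C (batch A (Suc t) \<omega>)) \<omega>
        = real_cond_exp (prob_of A)
          (vimage_algebra (space (prob_of A))
             (\<lambda>\<omega>. (batches A t \<omega>, data A \<omega>))
             (batches_space A t \<Otimes>\<^sub>M data_space A))
          (\<lambda>\<omega>. indicator C (batch A (Suc t) \<omega>)) \<omega>)"

definition bounded_direction :: "nat \<Rightarrow> real \<Rightarrow> ('w, 'z, 'o) noisy_alg \<Rightarrow> bool" where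
  "bounded_direction d L A \<longleftrightarrow>
     (\<forall>w\<in>space (Rd d). \<forall>z\<in>space (batch_space A). norm1 d (direction A w z) \<le> L)"

definition laplace_noise :: "nat \<Rightarrow> nat \<Rightarrow> (nat \<Rightarrow> real) \<Rightarrow> ('w, 'z, 'o) noisy_alg \<Rightarrow> bool" where
  "laplace_noise d T \<sigma> A \<longleftrightarrow>
     (\<forall>t\<in>{1..T}.
        prob_space.indep_vars (prob_of A) (\<lambda>_. borel) (\<lambda>i \<omega>. noise A t \<omega> i) {..<d} \<and>
        (\<forall>i<d. distributed (prob_of A) lborel (\<lambda>\<omega>. noise A t \<omega> i)
                 (\<lambda>x. ennreal (laplace_density 0 (\<sigma> t / sqrt 2) x))))"

definition laplace_noisy_iterative ::
  "nat \<Rightarrow> nat \<Rightarrow> real \<Rightarrow> (nat \<Rightarrow> real) \<Rightarrow> (nat \<Rightarrow> real) \<Rightarrow> ('w, 'z, 'o) noisy_alg \<Rightarrow> bool" where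
  "laplace_noisy_iterative d T L \<eta> \<sigma> A \<longleftrightarrow>
     noisy_iterative d T \<eta> A \<and> nonadaptive_sampling d T A \<and>
     bounded_direction d L A \<and> laplace_noise d T \<sigma> A"

definition leakage :: "nat \<Rightarrow> ('w, 'z, 'o) noisy_alg \<Rightarrow> ereal" where
  "leakage T A = max_leakage (prob_of A) (data_space A) (data A) (out_space A) (final_output A T)"

end

theory Submission
  imports Defs
begin

text \<open>Shifting a product Laplace density with rate \<open>c\<close> by a vector of 1-norm at most \<open>r\<close> keeps it
  below the envelope \<open>(c / 2) ^ d * exp (- c * max 0 (norm1 d x - r))\<close>, whose total mass is the
  \<open>d\<close>-th partial sum of the exponential series at \<open>c * r\<close>. Hence the law of the trajectory given
  the data and the batches is at most the product of these masses times the law of the process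
  without directions, driven by noise whose density is the normalised envelope. This second law does
  not depend on the data, so it serves as \<open>Q\<close> in the leakage, and the mass product bounds the
  likelihood ratio. The limit statement holds because a partial sum of the exponential series at
  \<open>c * r\<close> is at most \<open>exp (c * r)\<close>.\<close>

section \<open>The Laplace envelope\<close>

text \<open>Total mass of the envelope in dimension \<open>d\<close>. Negative \<open>r\<close> occur in the induction on \<open>d\<close>, where
  integrating out a coordinate \<open>x\<close> replaces \<open>r\<close> by \<open>r - \<bar>x\<bar>\<close>.\<close>

definition trunc_exp :: "real \<Rightarrow> nat \<Rightarrow> real \<Rightarrow> real" where
  "trunc_exp c d r = (if r \<in> {..<0} then exp (c * r) else (\<Sum>i\<le>d. (c * r) ^ i / fact i))"

lemma trunc_exp_nonneg: "c > 0 \<Longrightarrow> 0 \<le> trunc_exp c d r"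
  by (auto simp: trunc_exp_def intro!: sum_nonneg)

lemma measurable_trunc_exp [measurable]: "trunc_exp c d \<in> borel_measurable borel"
  unfolding trunc_exp_def[abs_def] by measurable

text \<open>Each term of the sum differentiates to \<open>c\<close> times the preceding one and the
  constant term disappears, so the degree drops by one.\<close>

lemma DERIV_exp_partial_sum:
  "((\<lambda>r::real. \<Sum>i\<le>Suc d. (c * r) ^ i / fact i) has_real_derivative
      c * (\<Sum>i\<le>d. (c * r) ^ i / fact i)) (at r within S)"
proof -
  have "((\<lambda>r. \<Sum>i\<le>Suc d. (c * r) ^ i / fact i) has_real_derivative
      (\<Sum>i\<le>Suc d. real i * (c * (c * r) ^ (i - 1)) / fact i)) (at r within S)"
    by (intro DERIV_sum) (auto intro!: derivative_eq_intros)
  also have "(\<Sum>i\<le>Suc d. real i * (c * (c * r) ^ (i - 1)) / fact i)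
      = (\<Sum>i\<le>d. c * ((c * r) ^ i / fact i))"
    unfolding sum.atMost_Suc_shift by (auto intro!: sum.cong simp del: of_nat_Suc)
  finally show ?thesis by (simp add: sum_distrib_left)
qed

lemma zero_partial_sum: "(\<Sum>i\<le>d. (c * 0) ^ i / fact i) = (1::real)"
  by (induction d) auto

text \<open>The exponential and the partial sum of degree \<open>Suc d\<close> share the value 1 and
  the derivative \<open>c\<close> at 0, so they glue to a differentiable function. Degree at least 1
  matters: for degree 0 and \<open>c > 0\<close> the glued function has a corner at 0.\<close>

lemma DERIV_trunc_exp:
  "(trunc_exp c (Suc d) has_real_derivative c * trunc_exp c d r) (at r)"
proof -
  have "((\<lambda>x. if x \<in> {..<0} then exp (c * x) else (\<Sum>i\<le>Suc d. (c * x) ^ i / fact i))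
      has_vector_derivative
      (if r \<in> {..<0} then c * exp (c * r) else c * (\<Sum>i\<le>d. (c * r) ^ i / fact i)))
      (at r within UNIV)"
  proof (rule has_vector_derivative_If_within_closures[where T = "{0..}"])
    show "UNIV = {..<0} \<union> {(0::real)..}" by auto
    show "((\<lambda>x. exp (c * x)) has_vector_derivative c * exp (c * r)) (at r within S)" for S
      unfolding has_real_derivative_iff_has_vector_derivative[symmetric]
      by (auto intro!: derivative_eq_intros)
    show "((\<lambda>x. \<Sum>i\<le>Suc d. (c * x) ^ i / fact i) has_vector_derivative
        c * (\<Sum>i\<le>d. (c * r) ^ i / fact i)) (at r within S)" for S
      unfolding has_real_derivative_iff_has_vector_derivative[symmetric]
      by (rule DERIV_exp_partial_sum)
    assume "r \<in> closure {..<0}" "r \<in> closure {0..}"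
    then have r: "r = 0" by simp
    show "exp (c * r) = (\<Sum>i\<le>Suc d. (c * r) ^ i / fact i)"
      unfolding r zero_partial_sum by simp
    show "c * exp (c * r) = c * (\<Sum>i\<le>d. (c * r) ^ i / fact i)"
      unfolding r zero_partial_sum by simp
  qed auto
  then show ?thesis
    unfolding has_real_derivative_iff_has_vector_derivative trunc_exp_def[abs_def]
    by (simp add: if_distrib[of "(*) c"])
qed

lemma trunc_exp_at_bot: "c > 0 \<Longrightarrow> (trunc_exp c d \<longlongrightarrow> 0) at_bot"
proof -
  assume c: "c > 0"
  have "filterlim (\<lambda>r. c * r) at_bot at_bot"
    using c by (intro filterlim_tendsto_pos_mult_at_bot[OF tendsto_const _ filterlim_ident])
  then have "((\<lambda>r. exp (c * r)) \<longlongrightarrow> 0) at_bot"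
    by (rule filterlim_compose[OF exp_at_bot])
  moreover have "\<forall>\<^sub>F r in at_bot. exp (c * r) = trunc_exp c d r"
    using eventually_gt_at_bot[of 0] by eventually_elim (simp add: trunc_exp_def)
  ultimately show ?thesis by (rule Lim_transform_eventually)
qed

lemma nn_integral_lborel_abs:
  fixes f :: "real \<Rightarrow> ennreal"
  assumes [measurable]: "f \<in> borel_measurable borel"
  shows "(\<integral>\<^sup>+x. f \<bar>x\<bar> \<partial>lborel) = 2 * (\<integral>\<^sup>+x. f x * indicator {0..} x \<partial>lborel)"
proof -
  let ?g = "\<lambda>x. f x * indicator {0..} x"
  have "(\<integral>\<^sup>+x. f \<bar>x\<bar> \<partial>lborel) = (\<integral>\<^sup>+x. ?g x + ?g (- x) \<partial>lborel)"
    \<comment> \<open>The two integrands can differ only at 0, where both halves contribute.\<close>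
    using AE_lborel_singleton[of 0]
    by (intro nn_integral_cong_AE) (auto elim!: eventually_mono simp: indicator_def)
  also have "\<dots> = (\<integral>\<^sup>+x. ?g x \<partial>lborel) + (\<integral>\<^sup>+x. ?g (- x) \<partial>lborel)"
    by (intro nn_integral_add) auto
  also have "(\<integral>\<^sup>+x. ?g (- x) \<partial>lborel) = (\<integral>\<^sup>+x. ?g x \<partial>lborel)"
    using nn_integral_real_affine[of ?g "-1" 0] by simp
  finally show ?thesis by (simp add: mult_2)
qed

text \<open>Integrating out one coordinate raises the degree by one. By symmetry the integral is
  twice that over the half line, which cancels the 2 in the Laplace constant \<open>c / 2\<close>.
  There \<open>- trunc_exp c (Suc d) (r - x)\<close> is an antiderivative, and it vanishes for large
  \<open>x\<close> because \<open>r - x\<close> becomes negative and \<open>trunc_exp\<close> is an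
  exponential there.\<close>

lemma nn_integral_trunc_exp:
  assumes c: "c > 0"
  shows "(\<integral>\<^sup>+x. ennreal (c / 2 * trunc_exp c d (r - \<bar>x\<bar>)) \<partial>lborel) = ennreal (trunc_exp c (Suc d) r)"
proof -
  have "(\<integral>\<^sup>+x. ennreal (c * trunc_exp c d (r - x)) * indicator {0..} x \<partial>lborel)
      = ennreal (0 - (- trunc_exp c (Suc d) (r - 0)))"
  proof (rule nn_integral_FTC_atLeast)
    show "((\<lambda>x. - trunc_exp c (Suc d) (r - x)) has_real_derivative c * trunc_exp c d (r - x)) (at x)" for x
      by (rule derivative_eq_intros DERIV_chain2[OF DERIV_trunc_exp] refl)+ simp
    have "filterlim (\<lambda>x::real. r - x) at_bot at_top"
      unfolding filterlim_at_bot
    proof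
      fix Z show "\<forall>\<^sub>F x in at_top. r - x \<le> Z"
        using eventually_ge_at_top[of "r - Z"] by eventually_elim simp
    qed
    from filterlim_compose[OF trunc_exp_at_bot[OF c] this]
    show "((\<lambda>x. - trunc_exp c (Suc d) (r - x)) \<longlongrightarrow> 0) at_top"
      using tendsto_minus by fastforce
  qed (use c in \<open>auto intro!: mult_nonneg_nonneg trunc_exp_nonneg\<close>)
  moreover have "(\<integral>\<^sup>+x. ennreal (c / 2 * trunc_exp c d (r - \<bar>x\<bar>)) \<partial>lborel)
      = 2 * (\<integral>\<^sup>+x. ennreal (c / 2 * trunc_exp c d (r - x)) * indicator {0..} x \<partial>lborel)"
    by (rule nn_integral_lborel_abs[of "\<lambda>x. ennreal (c / 2 * trunc_exp c d (r - x))"]) measurable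
  moreover have "\<dots> = (\<integral>\<^sup>+x. ennreal (c * trunc_exp c d (r - x)) * indicator {0..} x \<partial>lborel)"
  proof -
    have "2 * ennreal (c / 2 * y) = ennreal (c * y)" for y
      using ennreal_mult'[of 2 "c / 2 * y"] by simp
    then show ?thesis
      by (subst nn_integral_cmult[symmetric]) (auto simp: mult.assoc[symmetric])
  qed
  ultimately show ?thesis by simp
qed

section \<open>Mass of the envelope in dimension \<open>d\<close>\<close>

lemma norm1_upd: "norm1 (Suc d) (x(d := y)) = norm1 d x + \<bar>y\<bar>"
  by (simp add: norm1_def)

lemma measurable_norm1 [measurable]: "norm1 d \<in> borel_measurable (Rd d)"
  unfolding norm1_def[abs_def] by measurable

abbreviation lebesgue_Rd :: "nat \<Rightarrow> (nat \<Rightarrow> real) measure" where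
  "lebesgue_Rd d \<equiv> PiM {..<d} (\<lambda>_. lborel)"

text \<open>\<open>Rd d\<close> supplies only the sigma-algebra of the state space, while integrals
  need Lebesgue measure on each factor; this equality moves measurability between the two.\<close>

lemma sets_lebesgue_Rd: "sets (lebesgue_Rd d) = sets (Rd d)"
  by (intro sets_PiM_cong) auto

lemmas measurable_lebesgue_Rd = measurable_cong_sets[OF sets_lebesgue_Rd refl]

interpretation lborel_fam: product_sigma_finite "\<lambda>_::nat. lborel :: real measure"
  by standard

text \<open>For \<open>c > 0\<close> and \<open>r \<ge> 0\<close> this is the pointwise supremum of
  the product Laplace density over all shifts of 1-norm at most \<open>r\<close>: the term
  \<open>max 0 (norm1 d x - r)\<close> is the distance from \<open>x\<close> to the 1-norm ball of
  radius \<open>r\<close>.\<close>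

definition laplace_envelope :: "real \<Rightarrow> nat \<Rightarrow> real \<Rightarrow> (nat \<Rightarrow> real) \<Rightarrow> real" where
  "laplace_envelope c d r x = (c / 2) ^ d * exp (- c * max 0 (norm1 d x - r))"

lemma measurable_laplace_envelope [measurable]: "laplace_envelope c d r \<in> borel_measurable (Rd d)"
  unfolding laplace_envelope_def[abs_def] by measurable

text \<open>Fixing the last coordinate \<open>y\<close> leaves \<open>c / 2\<close> times the
  envelope of one dimension less with radius \<open>r - \<bar>y\<bar>\<close>, so the induction
  reduces to \<open>nn_integral_trunc_exp\<close>. In dimension 0 the space is a single point of
  norm 0, and the envelope there is 1 or \<open>exp (c * r)\<close> according to the sign of
  \<open>r\<close>.\<close>

lemma nn_integral_laplace_envelope:
  assumes c: "c > 0"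
  shows "(\<integral>\<^sup>+x. ennreal (laplace_envelope c d r x) \<partial>lebesgue_Rd d) = ennreal (trunc_exp c d r)"
proof (induction d arbitrary: r)
  case 0
  then show ?case
    by (simp add: PiM_empty nn_integral_count_space_finite laplace_envelope_def norm1_def trunc_exp_def max_def)
next
  case (Suc d)
  have "(\<integral>\<^sup>+x. ennreal (laplace_envelope c (Suc d) r x) \<partial>lebesgue_Rd (Suc d))
      = (\<integral>\<^sup>+y. \<integral>\<^sup>+x. ennreal (laplace_envelope c (Suc d) r (x(d := y))) \<partial>lebesgue_Rd d \<partial>lborel)"
    unfolding lessThan_Suc
    by (subst lborel_fam.product_nn_integral_insert_rev)
       (auto simp: lessThan_Suc[symmetric] measurable_lebesgue_Rd)
  also have "\<dots> = (\<integral>\<^sup>+y. \<integral>\<^sup>+x. ennreal (c / 2) * ennreal (laplace_envelope c d (r - \<bar>y\<bar>) x) \<partial>lebesgue_Rd d \<partial>lborel)"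
    using c
    by (intro nn_integral_cong)
      (simp add: laplace_envelope_def norm1_upd ennreal_mult''[symmetric] algebra_simps)
  also have "\<dots> = (\<integral>\<^sup>+y. ennreal (c / 2 * trunc_exp c d (r - \<bar>y\<bar>)) \<partial>lborel)"
    using c by (subst nn_integral_cmult)
      (auto simp: Suc.IH ennreal_mult''[symmetric] trunc_exp_nonneg measurable_lebesgue_Rd)
  finally show ?case unfolding nn_integral_trunc_exp[OF c] .
qed

section \<open>Translations and the one-step comparison\<close>

definition translate :: "nat \<Rightarrow> (nat \<Rightarrow> real) \<Rightarrow> (nat \<Rightarrow> real) \<Rightarrow> (nat \<Rightarrow> real)" where
  "translate d a x = (\<lambda>i\<in>{..<d}. a i + x i)"

lemma translate_in_space [simp]: "translate d a x \<in> space (Rd d)"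
  by (simp add: translate_def space_PiM)

lemma measurable_translate [measurable (raw)]:
  assumes [measurable]: "f \<in> measurable N (Rd d)" "g \<in> measurable N (Rd d)"
  shows "(\<lambda>x. translate d (f x) (g x)) \<in> measurable N (Rd d)"
  unfolding translate_def by measurable

lemma measurable_translate_const: "translate d a \<in> measurable (Rd d) (Rd d)"
  unfolding translate_def[abs_def] by measurable

text \<open>A product measure is determined by boxes. The preimage of a box is the box of shifted
  sides, and \<open>lborel\<close> is translation invariant in each coordinate.\<close>

lemma distr_translate_lebesgue_Rd:
  "distr (lebesgue_Rd d) (lebesgue_Rd d) (translate d b) = lebesgue_Rd d"
proof (rule lborel_fam.PiM_eqI)
  have meas: "translate d b \<in> measurable (lebesgue_Rd d) (lebesgue_Rd d)"
    using measurable_translate_const measurable_cong_sets[OF sets_lebesgue_Rd sets_lebesgue_Rd] by blast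
  fix A :: "nat \<Rightarrow> real set" assume A: "\<And>i. i \<in> {..<d} \<Longrightarrow> A i \<in> sets lborel"
  have "emeasure (distr (lebesgue_Rd d) (lebesgue_Rd d) (translate d b)) (Pi\<^sub>E {..<d} A)
      = emeasure (lebesgue_Rd d) (translate d b -` (Pi\<^sub>E {..<d} A) \<inter> space (lebesgue_Rd d))"
    using A meas by (intro emeasure_distr sets_PiM_I_finite) auto
  also have "translate d b -` (Pi\<^sub>E {..<d} A) \<inter> space (lebesgue_Rd d)
      = Pi\<^sub>E {..<d} (\<lambda>i. (+) (b i) -` A i \<inter> space lborel)"
    by (auto simp: translate_def space_PiM PiE_iff)
  also have "emeasure (lebesgue_Rd d) \<dots> = (\<Prod>i<d. emeasure lborel ((+) (b i) -` A i \<inter> space lborel))"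
    using A by (intro lborel_fam.emeasure_PiM) (auto intro!: measurable_sets_borel[of _ borel])
  also have "\<dots> = (\<Prod>i<d. emeasure lborel (A i))"
  proof (rule prod.cong)
    fix i assume "i \<in> {..<d}"
    then have "emeasure (distr lborel borel ((+) (b i))) (A i) = emeasure lborel ((+) (b i) -` A i \<inter> space lborel)"
      using A by (intro emeasure_distr) auto
    then show "emeasure lborel ((+) (b i) -` A i \<inter> space lborel) = emeasure lborel (A i)"
      by (simp add: lborel_distr_plus)
  qed simp
  finally show "emeasure (distr (lebesgue_Rd d) (lebesgue_Rd d) (translate d b)) (Pi\<^sub>E {..<d} A)
    = (\<Prod>i<d. emeasure lborel (A i))" .
qed auto

lemma nn_integral_translate:
  assumes f: "f \<in> borel_measurable (Rd d)"
  shows "(\<integral>\<^sup>+x. f (translate d b x) \<partial>lebesgue_Rd d) = (\<integral>\<^sup>+x. f x \<partial>lebesgue_Rd d)"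
proof -
  have "translate d b \<in> measurable (lebesgue_Rd d) (lebesgue_Rd d)"
    using measurable_translate_const measurable_cong_sets[OF sets_lebesgue_Rd sets_lebesgue_Rd] by blast
  with f have "(\<integral>\<^sup>+x. f x \<partial>distr (lebesgue_Rd d) (lebesgue_Rd d) (translate d b))
      = (\<integral>\<^sup>+x. f (translate d b x) \<partial>lebesgue_Rd d)"
    by (intro nn_integral_distr) (auto simp: measurable_lebesgue_Rd)
  then show ?thesis by (simp add: distr_translate_lebesgue_Rd)
qed

text \<open>For \<open>r = 0\<close> this is the product Laplace law with scale \<open>1 / c\<close>.\<close>

definition envelope_law :: "real \<Rightarrow> nat \<Rightarrow> real \<Rightarrow> (nat \<Rightarrow> real) measure" where
  "envelope_law c d r =
     density (lebesgue_Rd d) (\<lambda>x. ennreal (laplace_envelope c d r x / trunc_exp c d r))"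

lemma sets_envelope_law [measurable_cong, simp]: "sets (envelope_law c d r) = sets (Rd d)"
  by (simp add: envelope_law_def sets_lebesgue_Rd)

lemma trunc_exp_pos: "c > 0 \<Longrightarrow> 0 < trunc_exp c d r"
  by (auto simp: trunc_exp_def intro!: sum_pos2[of _ 0])

lemma laplace_envelope_nonneg: "c > 0 \<Longrightarrow> 0 \<le> laplace_envelope c d r x"
  by (simp add: laplace_envelope_def)

lemma trunc_exp_0 [simp]: "trunc_exp c d 0 = 1"
  unfolding trunc_exp_def using zero_partial_sum[of c d] by simp

text \<open>Keeping the mass on the left avoids division in \<open>ennreal\<close>. For
  \<open>r = 0\<close> the mass is 1 and the formula is integration against the Laplace density
  itself.\<close>

lemma nn_integral_envelope_law:
  assumes c: "c > 0" and f: "f \<in> borel_measurable (Rd d)"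
  shows "ennreal (trunc_exp c d r) * (\<integral>\<^sup>+x. f x \<partial>envelope_law c d r)
       = (\<integral>\<^sup>+x. ennreal (laplace_envelope c d r x) * f x \<partial>lebesgue_Rd d)"
proof -
  have "(\<integral>\<^sup>+x. f x \<partial>envelope_law c d r)
      = (\<integral>\<^sup>+x. ennreal (laplace_envelope c d r x / trunc_exp c d r) * f x \<partial>lebesgue_Rd d)"
    unfolding envelope_law_def using f
    by (intro nn_integral_density) (auto simp: measurable_lebesgue_Rd)
  moreover have "ennreal (trunc_exp c d r) * \<dots>
      = (\<integral>\<^sup>+x. ennreal (trunc_exp c d r) * (ennreal (laplace_envelope c d r x / trunc_exp c d r) * f x) \<partial>lebesgue_Rd d)"
    using f by (intro nn_integral_cmult[symmetric]) (auto simp: measurable_lebesgue_Rd)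
  moreover have "ennreal (trunc_exp c d r) * (ennreal (laplace_envelope c d r x / trunc_exp c d r) * f x)
      = ennreal (laplace_envelope c d r x) * f x" for x
    using trunc_exp_pos[OF c, of d r] laplace_envelope_nonneg[OF c, of d r x]
    by (simp add: mult.assoc[symmetric] ennreal_mult'[symmetric])
  ultimately show ?thesis by simp
qed

lemma prob_space_envelope_law:
  assumes c: "c > 0"
  shows "prob_space (envelope_law c d r)"
proof
  have "ennreal (trunc_exp c d r) * emeasure (envelope_law c d r) (space (envelope_law c d r))
      = ennreal (trunc_exp c d r)"
    using nn_integral_envelope_law[OF c, of "\<lambda>_. 1" d r] nn_integral_laplace_envelope[OF c, of d r] by simp
  then show "emeasure (envelope_law c d r) (space (envelope_law c d r)) = 1"
    using trunc_exp_pos[OF c, of d r]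
    by (metis ennreal_mult_cancel_left mult.right_neutral ennreal_eq_0_iff ennreal_neq_top not_less)
qed

text \<open>By the reverse triangle inequality the norm of the shifted point is at least
  \<open>norm1 d y - r\<close>; it is also nonnegative, hence at least the maximum in the exponent
  of the envelope.\<close>

lemma laplace_envelope_shift_le:
  assumes c: "c > 0" and v: "norm1 d v \<le> r"
  shows "laplace_envelope c d 0 (translate d v y) \<le> laplace_envelope c d r y"
proof -
  have "norm1 d y \<le> (\<Sum>i<d. \<bar>v i + y i\<bar> + \<bar>v i\<bar>)"
    unfolding norm1_def by (intro sum_mono) linarith
  then have "norm1 d y - r \<le> norm1 d (translate d v y)"
    using v by (simp add: norm1_def translate_def sum.distrib)
  moreover have "0 \<le> norm1 d (translate d v y)"
    by (simp add: norm1_def sum_nonneg)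
  ultimately show ?thesis
    using c by (auto simp: laplace_envelope_def intro!: mult_left_mono)
qed

text \<open>The substitution \<open>x = v + y\<close> with \<open>v = b - a\<close> moves the centre
  from \<open>a\<close> to \<open>b\<close> and turns the density into a shifted Laplace density at
  \<open>y\<close>. The envelope dominates it, and normalising the envelope costs the factor
  \<open>trunc_exp c d r\<close>.\<close>

lemma laplace_step_le:
  assumes c: "c > 0" and ab: "norm1 d (\<lambda>i. b i - a i) \<le> r"
    and f [measurable]: "f \<in> borel_measurable (Rd d)"
    and a: "a \<in> space (Rd d)" and b: "b \<in> space (Rd d)"
  shows "(\<integral>\<^sup>+x. f (translate d a x) \<partial>envelope_law c d 0)
     \<le> ennreal (trunc_exp c d r) * (\<integral>\<^sup>+x. f (translate d b x) \<partial>envelope_law c d r)"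
proof -
  define v where "v = (\<lambda>i. b i - a i)"
  have [measurable]: "(\<lambda>x. f (translate d u x)) \<in> borel_measurable (Rd d)" for u
    by (rule measurable_compose[OF measurable_translate_const f])
  have tr: "translate d a (translate d v y) = translate d b y" for y
    by (auto simp: translate_def v_def restrict_def)
  have "(\<integral>\<^sup>+x. f (translate d a x) \<partial>envelope_law c d 0)
      = (\<integral>\<^sup>+x. ennreal (laplace_envelope c d 0 x) * f (translate d a x) \<partial>lebesgue_Rd d)"
    using nn_integral_envelope_law[OF c, of "\<lambda>x. f (translate d a x)" d 0] by simp
  also have "\<dots> = (\<integral>\<^sup>+y. ennreal (laplace_envelope c d 0 (translate d v y)) * f (translate d b y) \<partial>lebesgue_Rd d)"
    by (subst nn_integral_translate[of _ d v, symmetric]) (auto simp: tr)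
  also have "\<dots> \<le> (\<integral>\<^sup>+y. ennreal (laplace_envelope c d r y) * f (translate d b y) \<partial>lebesgue_Rd d)"
    using laplace_envelope_shift_le[OF c, of d v r] ab
    by (intro nn_integral_mono mult_right_mono ennreal_leI) (auto simp: v_def)
  also have "\<dots> = ennreal (trunc_exp c d r) * (\<integral>\<^sup>+x. f (translate d b x) \<partial>envelope_law c d r)"
    by (rule nn_integral_envelope_law[OF c, symmetric]) measurable
  finally show ?thesis .
qed

section \<open>Comparison of the noisy processes\<close>

text \<open>The path is a deterministic function of the initial point \<open>w\<close> and the
  noises \<open>\<xi>\<close>, so its law is the image of a product law. \<open>a s\<close> gives
  the noiseless position at time \<open>s\<close> from the state at time
  \<open>s - 1\<close>.\<close>

primrec noisy_path :: "nat \<Rightarrow> (nat \<Rightarrow> (nat \<Rightarrow> real) \<Rightarrow> (nat \<Rightarrow> real)) \<Rightarrow> (nat \<Rightarrow> real)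
    \<Rightarrow> (nat \<Rightarrow> nat \<Rightarrow> real) \<Rightarrow> nat \<Rightarrow> (nat \<Rightarrow> real)" where
  "noisy_path d a w \<xi> 0 = w"
| "noisy_path d a w \<xi> (Suc t) = translate d (a (Suc t) (noisy_path d a w \<xi> t)) (\<xi> (Suc t))"

lemma noisy_path_in_space: "w \<in> space (Rd d) \<Longrightarrow> noisy_path d a w \<xi> t \<in> space (Rd d)"
  by (cases t) auto

lemma noisy_path_cong:
  "(\<And>s. s \<in> {1..t} \<Longrightarrow> \<xi> s = \<xi>' s) \<Longrightarrow> noisy_path d a w \<xi> t = noisy_path d a w \<xi>' t"
  by (induction t) auto

text \<open>The parameter \<open>x\<close> bundles all random inputs. The drift may depend on it,
  through the batches, which is why joint measurability in parameter and state is assumed.\<close>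

lemma measurable_noisy_path:
  assumes "\<And>s. s \<in> {1..T} \<Longrightarrow> (\<lambda>(x, v). a x s v) \<in> measurable (N \<Otimes>\<^sub>M Rd d) (Rd d)"
    and "w \<in> measurable N (Rd d)"
    and "\<And>s. s \<in> {1..T} \<Longrightarrow> (\<lambda>x. \<xi> x s) \<in> measurable N (Rd d)"
    and "t \<le> T"
  shows "(\<lambda>x. noisy_path d (a x) (w x) (\<xi> x) t) \<in> measurable N (Rd d)"
  using assms(4)
proof (induction t)
  case 0
  then show ?case using assms(2) by simp
next
  case (Suc t)
  then have [measurable]: "(\<lambda>x. noisy_path d (a x) (w x) (\<xi> x) t) \<in> measurable N (Rd d)"
    "(\<lambda>(x, v). a x (Suc t) v) \<in> measurable (N \<Otimes>\<^sub>M Rd d) (Rd d)"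
    "(\<lambda>x. \<xi> x (Suc t)) \<in> measurable N (Rd d)"
    using assms(1,3) by auto
  show ?case by simp
qed

lemma measurable_noisy_path_restrict:
  assumes a: "\<And>s. s \<in> {1..t} \<Longrightarrow> a s \<in> measurable (Rd d) (Rd d)"
    and w: "w \<in> space (Rd d)" and M: "\<And>s. sets (M s) = sets (Rd d)"
  shows "(\<lambda>\<xi>. \<lambda>s\<in>{..t}. noisy_path d a w \<xi> s) \<in> measurable (PiM {1..t} M) (PiM {..t} (\<lambda>_. Rd d))"
proof (rule measurable_restrict, rule measurable_noisy_path)
  fix s assume s: "s \<in> {1..t}"
  note [measurable] = a[OF s]
  show "(\<lambda>(x, v). a s v) \<in> measurable (PiM {1..t} M \<Otimes>\<^sub>M Rd d) (Rd d)"
    by measurable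
  show "(\<lambda>x. x s) \<in> measurable (PiM {1..t} M) (Rd d)"
    using measurable_component_singleton[OF s, of M] by (simp add: M cong: measurable_cong_sets)
qed (use w in auto)

text \<open>The noise at time \<open>Suc t\<close> does not influence earlier states. In this form
  the last noise can be integrated separately for a fixed history.\<close>

lemma noisy_path_update:
  "(\<lambda>s\<in>{..Suc t}. noisy_path d a w (\<xi>(Suc t := y)) s)
    = (\<lambda>s\<in>{..t}. noisy_path d a w \<xi> s)(Suc t := translate d (a (Suc t) (noisy_path d a w \<xi> t)) y)"
proof
  fix s
  have "noisy_path d a w (\<xi>(Suc t := y)) s = noisy_path d a w \<xi> s" if "s \<le> t" for s
    using that by (intro noisy_path_cong) auto
  then show "(\<lambda>s\<in>{..Suc t}. noisy_path d a w (\<xi>(Suc t := y)) s) s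
    = ((\<lambda>s\<in>{..t}. noisy_path d a w \<xi> s)(Suc t := translate d (a (Suc t) (noisy_path d a w \<xi> t)) y)) s"
    by (auto simp: le_Suc_eq)
qed

text \<open>Induction on \<open>t\<close>, integrating the last noise first: for a fixed history,
  \<open>laplace_step_le\<close> exchanges the last drift \<open>a\<close> for \<open>b\<close> at
  the cost of one factor. What remains is a function of the shorter path, so the induction needs
  arbitrary \<open>f\<close> of the whole path and not only of its last state.\<close>

lemma noisy_path_law_le:
  assumes c: "\<And>s. c s > 0"
    and a: "\<And>s. s \<in> {1..t} \<Longrightarrow> a s \<in> measurable (Rd d) (Rd d)"
    and b: "\<And>s. s \<in> {1..t} \<Longrightarrow> b s \<in> measurable (Rd d) (Rd d)"
    and ab: "\<And>s v. s \<in> {1..t} \<Longrightarrow> v \<in> space (Rd d) \<Longrightarrow> norm1 d (\<lambda>i. b s v i - a s v i) \<le> r s"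
    and w: "w \<in> space (Rd d)"
    and f: "f \<in> borel_measurable (PiM {..t} (\<lambda>_. Rd d))"
  shows "(\<integral>\<^sup>+\<xi>. f (\<lambda>s\<in>{..t}. noisy_path d a w \<xi> s) \<partial>PiM {1..t} (\<lambda>s. envelope_law (c s) d 0))
     \<le> ennreal (\<Prod>s=1..t. trunc_exp (c s) d (r s)) *
       (\<integral>\<^sup>+\<xi>. f (\<lambda>s\<in>{..t}. noisy_path d b w \<xi> s) \<partial>PiM {1..t} (\<lambda>s. envelope_law (c s) d (r s)))"
  using a b ab f
proof (induction t arbitrary: f)
  case 0
  have base: "(\<integral>\<^sup>+\<xi>. f (\<lambda>s\<in>{..0}. noisy_path d a w \<xi> s) \<partial>PiM {1..0::nat} M) = f (\<lambda>s\<in>{..0}. w)" for a and M :: "nat \<Rightarrow> (nat \<Rightarrow> real) measure"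
    by (simp add: PiM_empty nn_integral_count_space_finite cong: restrict_cong)
  show ?case unfolding base by simp
next
  case (Suc t)
  note f [measurable] = Suc.prems(4)
  have am [measurable]: "a s \<in> measurable (Rd d) (Rd d)" "b s \<in> measurable (Rd d) (Rd d)"
    if "s \<in> {1..Suc t}" for s
    using Suc.prems(1,2) that by auto
  \<comment> \<open>The radii \<open>\<rho>\<close> stay free, so that one splitting identity serves
    for the original noise, \<open>\<rho> = 0\<close>, and for the enlarged noise,
    \<open>\<rho> = r\<close>.\<close>
  interpret P: product_sigma_finite "\<lambda>s. envelope_law (c s) d (\<rho> s)" for \<rho> :: "nat \<Rightarrow> real"
    using prob_space_envelope_law[OF c]
    by (intro product_sigma_finite.intro prob_space_imp_sigma_finite)
  interpret E: prob_space "envelope_law (c s) d (\<rho> s)" for s \<rho>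
    by (rule prob_space_envelope_law[OF c])
  have ins: "{1..Suc t} = insert (Suc t) {1..t}" "Suc t \<notin> {1..t}" "finite {1..t}"
    by auto
  have upd [measurable]: "(\<lambda>x. (\<tau> x)(Suc t := \<upsilon> x)) \<in> measurable N (PiM {..Suc t} (\<lambda>_. Rd d))"
    if "\<tau> \<in> measurable N (PiM {..t} (\<lambda>_. Rd d))" "\<upsilon> \<in> measurable N (Rd d)"
    for N :: "'n measure" and \<tau> \<upsilon>
    using that by (intro measurable_fun_upd[where J = "{..t}"]) auto
  have split: "(\<integral>\<^sup>+\<xi>. f (\<lambda>s\<in>{..Suc t}. noisy_path d h w \<xi> s) \<partial>PiM {1..Suc t} (\<lambda>s. envelope_law (c s) d (\<rho> s)))
      = (\<integral>\<^sup>+\<xi>. \<integral>\<^sup>+y. f ((\<lambda>s\<in>{..t}. noisy_path d h w \<xi> s)(Suc t := translate d (h (Suc t) (noisy_path d h w \<xi> t)) y))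
          \<partial>envelope_law (c (Suc t)) d (\<rho> (Suc t)) \<partial>PiM {1..t} (\<lambda>s. envelope_law (c s) d (\<rho> s)))"
    if h: "\<And>s. s \<in> {1..Suc t} \<Longrightarrow> h s \<in> measurable (Rd d) (Rd d)" for h \<rho>
  proof -
    have "(\<lambda>\<xi>. f (\<lambda>s\<in>{..Suc t}. noisy_path d h w \<xi> s)) \<in> borel_measurable (PiM {1..Suc t} (\<lambda>s. envelope_law (c s) d (\<rho> s)))"
      by (rule measurable_compose[OF measurable_noisy_path_restrict f]) (use h w in auto)
    then show ?thesis
      unfolding ins(1) using ins(2,3)
      by (subst P.product_nn_integral_insert) (auto simp: noisy_path_update)
  qed
  let ?C = "trunc_exp (c (Suc t)) d (r (Suc t))"
  \<comment> \<open>\<open>G\<close> averages \<open>f\<close> over a last step that already uses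
    the drift \<open>b\<close> and the enlarged noise. It depends only on the path up to time
    \<open>t\<close>, so the induction hypothesis applies to it once it is scaled by the cost of
    that step.\<close>
  define G where "G \<tau> = (\<integral>\<^sup>+y. f (\<tau>(Suc t := translate d (b (Suc t) (\<tau> t)) y))
      \<partial>envelope_law (c (Suc t)) d (r (Suc t)))" for \<tau>
  define g where "g \<tau> = ennreal ?C * G \<tau>" for \<tau>
  have G [measurable]: "G \<in> borel_measurable (PiM {..t} (\<lambda>_. Rd d))"
    unfolding G_def[abs_def] by measurable
  have g: "g \<in> borel_measurable (PiM {..t} (\<lambda>_. Rd d))"
    unfolding g_def[abs_def] by measurable
  have C: "0 \<le> trunc_exp (c s) d (r s)" for s
    using c by (intro trunc_exp_nonneg)
  have "(\<integral>\<^sup>+\<xi>. f (\<lambda>s\<in>{..Suc t}. noisy_path d a w \<xi> s) \<partial>PiM {1..Suc t} (\<lambda>s. envelope_law (c s) d 0))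
      \<le> (\<integral>\<^sup>+\<xi>. g (\<lambda>s\<in>{..t}. noisy_path d a w \<xi> s) \<partial>PiM {1..t} (\<lambda>s. envelope_law (c s) d 0))"
  proof (subst split[of a "\<lambda>_. 0"], rule am(1), assumption, rule nn_integral_mono)
    fix \<xi> :: "nat \<Rightarrow> nat \<Rightarrow> real"
    let ?\<tau> = "\<lambda>s\<in>{..t}. noisy_path d a w \<xi> s" and ?v = "noisy_path d a w \<xi> t"
    have \<tau>: "?\<tau> \<in> space (PiM {..t} (\<lambda>_. Rd d))"
      using noisy_path_in_space[OF w] by (auto simp: space_PiM PiE_iff)
    have v: "?v \<in> space (Rd d)" by (rule noisy_path_in_space[OF w])
    have "(\<integral>\<^sup>+y. f (?\<tau>(Suc t := translate d (a (Suc t) ?v) y)) \<partial>envelope_law (c (Suc t)) d 0)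
        \<le> ennreal ?C * (\<integral>\<^sup>+y. f (?\<tau>(Suc t := translate d (b (Suc t) ?v) y)) \<partial>envelope_law (c (Suc t)) d (r (Suc t)))"
    \<comment> \<open>With the history frozen, \<open>f\<close> is a function of the last state
      alone.\<close>
    proof (rule laplace_step_le[OF c Suc.prems(3)[OF _ v]])
      show "(\<lambda>y. f (?\<tau>(Suc t := y))) \<in> borel_measurable (Rd d)"
        using \<tau> by measurable
    qed (use v in \<open>auto intro: measurable_space[OF am(1)] measurable_space[OF am(2)]\<close>)
    then show "(\<integral>\<^sup>+y. f (?\<tau>(Suc t := translate d (a (Suc t) ?v) y)) \<partial>envelope_law (c (Suc t)) d 0) \<le> g ?\<tau>"
      by (simp add: g_def G_def)
  qed
  also have "\<dots> \<le> ennreal (\<Prod>s=1..t. trunc_exp (c s) d (r s)) *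
      (\<integral>\<^sup>+\<xi>. g (\<lambda>s\<in>{..t}. noisy_path d b w \<xi> s) \<partial>PiM {1..t} (\<lambda>s. envelope_law (c s) d (r s)))"
    by (rule Suc.IH[OF _ _ _ g]) (use Suc.prems in auto)
  \<comment> \<open>The constant leaves the integral, and the splitting is undone for the process
    with drift \<open>b\<close>.\<close>
  also have "(\<integral>\<^sup>+\<xi>. g (\<lambda>s\<in>{..t}. noisy_path d b w \<xi> s) \<partial>PiM {1..t} (\<lambda>s. envelope_law (c s) d (r s)))
      = ennreal ?C * (\<integral>\<^sup>+\<xi>. f (\<lambda>s\<in>{..Suc t}. noisy_path d b w \<xi> s) \<partial>PiM {1..Suc t} (\<lambda>s. envelope_law (c s) d (r s)))"
  proof -
    have "(\<lambda>\<xi>. G (\<lambda>s\<in>{..t}. noisy_path d b w \<xi> s)) \<in> borel_measurable (PiM {1..t} (\<lambda>s. envelope_law (c s) d (r s)))"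
      by (rule measurable_compose[OF measurable_noisy_path_restrict G]) (use am(2) w in auto)
    then have "(\<integral>\<^sup>+\<xi>. g (\<lambda>s\<in>{..t}. noisy_path d b w \<xi> s) \<partial>PiM {1..t} (\<lambda>s. envelope_law (c s) d (r s)))
        = ennreal ?C * (\<integral>\<^sup>+\<xi>. G (\<lambda>s\<in>{..t}. noisy_path d b w \<xi> s) \<partial>PiM {1..t} (\<lambda>s. envelope_law (c s) d (r s)))"
      unfolding g_def by (rule nn_integral_cmult)
    moreover have "G (\<lambda>s\<in>{..t}. noisy_path d b w \<xi> s) =
        (\<integral>\<^sup>+y. f ((\<lambda>s\<in>{..t}. noisy_path d b w \<xi> s)(Suc t := translate d (b (Suc t) (noisy_path d b w \<xi> t)) y))
          \<partial>envelope_law (c (Suc t)) d (r (Suc t)))" for \<xi>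
      unfolding G_def by simp
    ultimately show ?thesis
      by (subst split[of b r], use am(2) in blast) (simp only:)
  qed
  finally have le: "(\<integral>\<^sup>+\<xi>. f (\<lambda>s\<in>{..Suc t}. noisy_path d a w \<xi> s) \<partial>PiM {1..Suc t} (\<lambda>s. envelope_law (c s) d 0))
    \<le> ennreal (\<Prod>s=1..t. trunc_exp (c s) d (r s)) * (ennreal ?C *
      (\<integral>\<^sup>+\<xi>. f (\<lambda>s\<in>{..Suc t}. noisy_path d b w \<xi> s) \<partial>PiM {1..Suc t} (\<lambda>s. envelope_law (c s) d (r s))))" .
  have "ennreal (\<Prod>s=1..Suc t. trunc_exp (c s) d (r s)) = ennreal (\<Prod>s=1..t. trunc_exp (c s) d (r s)) * ennreal ?C"
    using C by (simp add: ennreal_mult prod_nonneg)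
  with le show ?case
    by (simp only: mult.assoc)
qed

section \<open>Independence and leakage\<close>

text \<open>Independence is the equality of both measures on rectangles, and these determine the
  product of two probability measures.\<close>

lemma indep_rvs_distr_eq:
  assumes "prob_space M" and XY: "indep_rvs M A X B Y"
  shows "distr M (A \<Otimes>\<^sub>M B) (\<lambda>\<omega>. (X \<omega>, Y \<omega>)) = distr M A X \<Otimes>\<^sub>M distr M B Y"
proof -
  interpret prob_space M by fact
  have X [measurable]: "X \<in> measurable M A" and Y [measurable]: "Y \<in> measurable M B"
    and ind: "indep_set {X -` C \<inter> space M | C. C \<in> sets A} {Y -` C \<inter> space M | C. C \<in> sets B}"
    using XY by (auto simp: indep_rvs_def)
  interpret X: prob_space "distr M A X" by (rule prob_space_distr) fact
  interpret Y: prob_space "distr M B Y" by (rule prob_space_distr) fact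
  have "distr M A X \<Otimes>\<^sub>M distr M B Y = distr M (A \<Otimes>\<^sub>M B) (\<lambda>\<omega>. (X \<omega>, Y \<omega>))"
  proof (rule pair_measure_eqI)
    fix C D assume CD: "C \<in> sets (distr M A X)" "D \<in> sets (distr M B Y)"
    then have "emeasure (distr M (A \<Otimes>\<^sub>M B) (\<lambda>\<omega>. (X \<omega>, Y \<omega>))) (C \<times> D)
        = emeasure M ((\<lambda>\<omega>. (X \<omega>, Y \<omega>)) -` (C \<times> D) \<inter> space M)"
      by (intro emeasure_distr) auto
    also have "(\<lambda>\<omega>. (X \<omega>, Y \<omega>)) -` (C \<times> D) \<inter> space M = (X -` C \<inter> space M) \<inter> (Y -` D \<inter> space M)"
      by auto
    also have "emeasure M \<dots> = ennreal (prob (X -` C \<inter> space M) * prob (Y -` D \<inter> space M))"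
      unfolding emeasure_eq_measure by (subst indep_setD[OF ind]) (use CD in auto)
    also have "\<dots> = emeasure (distr M A X) C * emeasure (distr M B Y) D"
      using CD by (simp add: emeasure_distr emeasure_eq_measure ennreal_mult)
    finally show "emeasure (distr M A X) C * emeasure (distr M B Y) D
        = emeasure (distr M (A \<Otimes>\<^sub>M B) (\<lambda>\<omega>. (X \<omega>, Y \<omega>))) (C \<times> D)" ..
  qed (auto intro: X.sigma_finite_measure_axioms Y.sigma_finite_measure_axioms)
  then show ?thesis ..
qed

lemma indep_vars_distr_PiM:
  assumes "prob_space M" and ind: "prob_space.indep_vars M M' X I"
  shows "distr M (PiM I M') (\<lambda>\<omega>. \<lambda>i\<in>I. X i \<omega>) = PiM I (\<lambda>i. distr M (M' i) (X i))"
proof (cases "I = {}")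
  \<comment> \<open>The empty family arises for \<open>T = 0\<close> and for \<open>d = 0\<close>.
    Both sides are then the unit mass at the everywhere undefined function.\<close>
  case True
  interpret prob_space M by fact
  have "distr M (count_space {\<lambda>_. undefined}) (\<lambda>\<omega> _. undefined) = count_space {\<lambda>_. undefined}"
  proof (rule measure_eqI)
    fix A assume "A \<in> sets (distr M (count_space {\<lambda>_. undefined}) (\<lambda>\<omega> _. undefined))"
    then have "A = {} \<or> A = {\<lambda>_. undefined}" by auto
    then show "emeasure (distr M (count_space {\<lambda>_. undefined}) (\<lambda>\<omega> _. undefined)) A
      = emeasure (count_space {\<lambda>_. undefined}) A"
      by (auto simp: emeasure_distr emeasure_space_1)
  qed simp
  then show ?thesis by (simp add: True PiM_empty restrict_def)
next
  case False
  interpret prob_space M by fact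
  have "\<And>i. i \<in> I \<Longrightarrow> random_variable (M' i) (X i)"
    using ind by (simp add: indep_vars_def2)
  with ind False show ?thesis by (simp add: indep_vars_iff_distr_eq_PiM')
qed

text \<open>The 1-norm is a sum over coordinates, so the envelope with \<open>r = 0\<close>
  factorises into one-dimensional Laplace densities and the two measures agree on boxes.\<close>

lemma PiM_laplace:
  assumes b: "b > 0"
  shows "PiM {..<d} (\<lambda>_. density lborel (\<lambda>x. ennreal (laplace_density 0 b x))) = envelope_law (1 / b) d 0"
    (is "PiM _ (\<lambda>_. ?L) = _")
proof -
  have [measurable]: "laplace_density 0 b \<in> borel_measurable borel"
    unfolding laplace_density_def[abs_def] by measurable
  \<comment> \<open>Written this way, the one-dimensional density has mass
    \<open>trunc_exp (1 / b) 1 0\<close>, which is 1.\<close>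
  have dens: "(1 / b) / 2 * trunc_exp (1 / b) 0 (0 - \<bar>x\<bar>) = laplace_density 0 b x" for x
    by (auto simp: trunc_exp_def laplace_density_def)
  have "(\<integral>\<^sup>+x. ennreal (laplace_density 0 b x) \<partial>lborel) = 1"
    using nn_integral_trunc_exp[of "1 / b" 0 0] b unfolding dens by simp
  then have "emeasure ?L (space ?L) = 1"
    by (simp add: emeasure_density)
  then interpret L: prob_space ?L by (rule prob_spaceI)
  interpret P: product_sigma_finite "\<lambda>_::nat. ?L"
    by (intro product_sigma_finite.intro L.sigma_finite_measure_axioms)
  have "envelope_law (1 / b) d 0 = PiM {..<d} (\<lambda>_. ?L)"
  proof (rule P.PiM_eqI)
    fix A :: "nat \<Rightarrow> real set" assume A: "\<And>i. i \<in> {..<d} \<Longrightarrow> A i \<in> sets ?L"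
    have meas: "Pi\<^sub>E {..<d} A \<in> sets (lebesgue_Rd d)"
      using A by (intro sets_PiM_I_finite) auto
    have prod: "ennreal (laplace_envelope (1 / b) d 0 x) * indicator (Pi\<^sub>E {..<d} A) x
        = (\<Prod>i<d. ennreal (laplace_density 0 b (x i)) * indicator (A i) (x i))"
      if "x \<in> space (lebesgue_Rd d)" for x
    proof -
      have "laplace_envelope (1 / b) d 0 x = (1 / b / 2) ^ d * exp (\<Sum>i<d. - (1 / b) * \<bar>x i\<bar>)"
        using b by (simp add: laplace_envelope_def norm1_def sum_nonneg sum_negf sum_divide_distrib)
      also have "\<dots> = (\<Prod>i<d. laplace_density 0 b (x i))"
        by (simp add: exp_sum laplace_density_def prod_dividef prod.distrib power_divide power_mult_distrib)
      finally have "ennreal (laplace_envelope (1 / b) d 0 x) = (\<Prod>i<d. ennreal (laplace_density 0 b (x i)))"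
        using b by (subst prod_ennreal) (auto simp: laplace_density_def)
      moreover have "indicator (Pi\<^sub>E {..<d} A) x = (\<Prod>i<d. indicator (A i) (x i) :: ennreal)"
      proof (cases "x \<in> Pi\<^sub>E {..<d} A")
        case True
        then show ?thesis by (simp add: PiE_mem)
      next
        case False
        \<comment> \<open>Extensionality excludes that \<open>x\<close> misses the box for its
          values outside \<open>{..<d}\<close>, so some coordinate must fail.\<close>
        moreover have "x \<in> extensional {..<d}"
          using that by (simp add: space_PiM PiE_iff)
        ultimately obtain i where "i < d" "x i \<notin> A i"
          by (auto simp: PiE_iff)
        then have "(\<Prod>i<d. indicator (A i) (x i) :: ennreal) = 0"
          by (intro prod_zero bexI[of _ i]) auto
        with False show ?thesis by simp
      qed
      ultimately show ?thesis by (simp add: prod.distrib)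
    qed
    have "emeasure (envelope_law (1 / b) d 0) (Pi\<^sub>E {..<d} A)
        = (\<integral>\<^sup>+x. ennreal (laplace_envelope (1 / b) d 0 x) * indicator (Pi\<^sub>E {..<d} A) x \<partial>lebesgue_Rd d)"
      unfolding envelope_law_def using meas
      by (simp add: emeasure_density measurable_lebesgue_Rd)
    also have "\<dots> = (\<integral>\<^sup>+x. (\<Prod>i<d. ennreal (laplace_density 0 b (x i)) * indicator (A i) (x i)) \<partial>lebesgue_Rd d)"
      by (intro nn_integral_cong prod)
    also have "\<dots> = (\<Prod>i<d. \<integral>\<^sup>+x. ennreal (laplace_density 0 b x) * indicator (A i) x \<partial>lborel)"
      using A by (intro lborel_fam.product_nn_integral_prod) auto
    also have "\<dots> = (\<Prod>i<d. emeasure ?L (A i))"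
      using A by (intro prod.cong) (auto simp: emeasure_density)
    finally show "emeasure (envelope_law (1 / b) d 0) (Pi\<^sub>E {..<d} A) = (\<Prod>i<d. emeasure ?L (A i))" .
  qed (auto intro!: sets_PiM_cong)
  then show ?thesis ..
qed

section \<open>Likelihood ratio bounds and maximal leakage\<close>

text \<open>On the set \<open>D\<close> where the derivative exceeds \<open>K\<close>, the excess
  integrates to \<open>P D - K * N D\<close>. Domination makes this truncated difference 0, so the
  excess vanishes almost everywhere. Finiteness of \<open>N\<close> makes the subtraction of
  integrals legitimate.\<close>

lemma AE_RN_deriv_le:
  assumes "finite_measure N" and sets: "sets P = sets N"
    and le: "\<And>C. C \<in> sets N \<Longrightarrow> emeasure P C \<le> ennreal K * emeasure N C"
  shows "absolutely_continuous N P" and "AE x in N. RN_deriv N P x \<le> ennreal K"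
proof -
  interpret finite_measure N by fact
  show ac: "absolutely_continuous N P"
    unfolding absolutely_continuous_def
  proof
    fix C assume "C \<in> null_sets N"
    with le[of C] show "C \<in> null_sets P" by (auto simp: null_sets_def sets)
  qed
  define D where "D = {x \<in> space N. ennreal K < RN_deriv N P x}"
  have D [measurable]: "D \<in> sets N"
    unfolding D_def by measurable
  have fin: "ennreal K * emeasure N D \<noteq> \<infinity>"
    by (simp add: ennreal_mult_eq_top_iff)
  have "(\<integral>\<^sup>+x. RN_deriv N P x * indicator D x - ennreal K * indicator D x \<partial>N)
      = (\<integral>\<^sup>+x. RN_deriv N P x * indicator D x \<partial>N) - (\<integral>\<^sup>+x. ennreal K * indicator D x \<partial>N)"
  proof (rule nn_integral_diff)
    show "(\<integral>\<^sup>+x. ennreal K * indicator D x \<partial>N) \<noteq> \<infinity>"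
      using fin by (simp add: nn_integral_cmult_indicator)
    show "AE x in N. ennreal K * indicator D x \<le> RN_deriv N P x * indicator D x"
      by (rule AE_I2) (auto simp: D_def indicator_def)
  qed auto
  also have "(\<integral>\<^sup>+x. RN_deriv N P x * indicator D x \<partial>N) = emeasure P D"
    using density_RN_deriv[OF ac sets] by (subst emeasure_density[symmetric]) auto
  also have "emeasure P D - (\<integral>\<^sup>+x. ennreal K * indicator D x \<partial>N) = 0"
    using le[OF D] fin by (simp add: nn_integral_cmult_indicator diff_eq_0_ennreal top.not_eq_extremum)
  finally have "AE x in N. RN_deriv N P x * indicator D x - ennreal K * indicator D x = 0"
    by (subst (asm) nn_integral_0_iff_AE) auto
  then show "AE x in N. RN_deriv N P x \<le> ennreal K"
    using AE_space
  proof eventually_elim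
    case (elim x)
    show ?case
    proof (cases "x \<in> D")
      case True
      then have "RN_deriv N P x - ennreal K = 0" using elim by simp
      then show ?thesis by (simp add: diff_eq_0_iff_ennreal)
    next
      case False
      then show ?thesis using elim by (simp add: D_def not_less)
    qed
  qed
qed

lemma ln_ennreal_le:
  assumes "K > 0" "x \<le> ennreal K"
  shows "ln_ennreal x \<le> ereal (ln K)"
proof (cases "x = 0")
  case True
  then show ?thesis by (simp add: ln_ennreal_def)
next
  case False
  have "x \<noteq> \<infinity>" using assms(2) by (auto simp: top_unique)
  moreover have "enn2real x \<le> K"
    using enn2real_mono[OF assms(2)] assms(1) by simp
  moreover have "0 < enn2real x"
    using False \<open>x \<noteq> \<infinity>\<close> by (simp add: enn2real_positive_iff zero_less_iff_neq_zero less_top)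
  ultimately show ?thesis
    using False assms(1) by (simp add: ln_ennreal_def)
qed

text \<open>The leakage is an infimum over \<open>Q\<close>, so a single candidate gives an upper
  bound, and for that candidate domination of measures bounds the likelihood ratio by
  \<open>K\<close>.\<close>

lemma max_leakage_le:
  assumes "prob_space M" and X: "X \<in> measurable M A"
    and Q: "prob_space Q" "sets Q = sets B" and K: "K > 0"
    and le: "\<And>C. C \<in> sets (A \<Otimes>\<^sub>M B) \<Longrightarrow>
      emeasure (distr M (A \<Otimes>\<^sub>M B) (\<lambda>\<omega>. (X \<omega>, Y \<omega>))) C \<le> ennreal K * emeasure (distr M A X \<Otimes>\<^sub>M Q) C"
  shows "max_leakage M A X B Y \<le> ereal (ln K)"
proof -
  let ?P = "distr M (A \<Otimes>\<^sub>M B) (\<lambda>\<omega>. (X \<omega>, Y \<omega>))" and ?N = "distr M A X \<Otimes>\<^sub>M Q"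
  interpret prob_space M by fact
  interpret X: prob_space "distr M A X" by (rule prob_space_distr) fact
  interpret Q: prob_space Q by fact
  interpret pair_prob_space "distr M A X" Q ..
  have sets: "sets ?P = sets ?N"
    unfolding sets_distr by (intro sets_pair_measure_cong) (simp_all add: Q)
  have fin: "finite_measure ?N" by unfold_locales
  have le': "emeasure ?P C \<le> ennreal K * emeasure ?N C" if "C \<in> sets ?N" for C
    using that sets by (intro le) simp
  note ac = AE_RN_deriv_le(1)[OF fin sets le'] and RN = AE_RN_deriv_le(2)[OF fin sets le']
  \<comment> \<open>The essential supremum is taken under the joint law; absolute continuity carries
    the bound over from the product law.\<close>
  have "AE x in ?P. RN_deriv ?N ?P x \<le> ennreal K"
    using absolutely_continuous_AE[OF sets ac RN] .
  moreover have "RN_deriv ?N ?P \<in> borel_measurable ?P"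
    by (simp only: measurable_cong_sets[OF sets refl] borel_measurable_RN_deriv)
  ultimately have "esssup ?P (RN_deriv ?N ?P) \<le> ennreal K"
    by (intro esssup_I)
  then have "renyi_div_inf ?P ?N \<le> ereal (ln K)"
    using ac sets K by (simp add: renyi_div_inf_def ln_ennreal_le)
  then show ?thesis
    unfolding max_leakage_def using Q by (intro INF_lower2[of Q]) auto
qed

section \<open>The algorithm as a function of its random inputs\<close>

definition drift_step ::
  "nat \<Rightarrow> (nat \<Rightarrow> real) \<Rightarrow> ('w, 'z, 'o) noisy_alg \<Rightarrow> (nat \<Rightarrow> 'z multiset) \<Rightarrow> nat \<Rightarrow> (nat \<Rightarrow> real) \<Rightarrow> (nat \<Rightarrow> real)"
  where "drift_step d \<eta> A z s v = (\<lambda>i\<in>{..<d}. drift A v i - \<eta> s * direction A v (z s) i)"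

text \<open>Unfolding the update rule shows that the iterates depend on chance only through the
  initial point, the batches and the noises, so their law follows from the joint law of these
  inputs.\<close>

lemma iterate_eq_noisy_path:
  assumes "noisy_iterative d T \<eta> A" "\<omega> \<in> space (prob_of A)" "t \<le> T"
  shows "iterate A t \<omega> =
    noisy_path d (drift_step d \<eta> A (batches A T \<omega>)) (iterate A 0 \<omega>) (noises A T \<omega>) t"
  using assms(3)
proof (induction t)
  case (Suc t)
  have "\<forall>t\<in>{1..T}. \<forall>\<omega>\<in>space (prob_of A). iterate A t \<omega> = (\<lambda>i\<in>{..<d}.
      drift A (iterate A (t - 1) \<omega>) i - \<eta> t * direction A (iterate A (t - 1) \<omega>) (batch A t \<omega>) i + noise A t \<omega> i)"
    using assms(1) unfolding noisy_iterative_def by blast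
  then have "iterate A (Suc t) \<omega> = (\<lambda>i\<in>{..<d}.
      drift A (iterate A t \<omega>) i - \<eta> (Suc t) * direction A (iterate A t \<omega>) (batch A (Suc t) \<omega>) i + noise A (Suc t) \<omega> i)"
    using assms(2) Suc.prems by force
  also have "\<dots> = translate d (drift_step d \<eta> A (batches A T \<omega>) (Suc t) (iterate A t \<omega>)) (noises A T \<omega> (Suc t))"
    using Suc.prems by (auto simp: translate_def drift_step_def batches_def noises_def)
  finally show ?case using Suc by simp
qed simp

lemma distr_noise:
  assumes "noisy_iterative d T \<eta> A" "laplace_noise d T \<sigma> A" and t: "t \<in> {1..T}" and "\<sigma> t > 0"
  shows "distr (prob_of A) (Rd d) (noise A t) = envelope_law (sqrt 2 / \<sigma> t) d 0"
proof -
  let ?M = "prob_of A"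
  have M: "prob_space ?M" and ind: "prob_space.indep_vars ?M (\<lambda>_. Rd d) (noise A) {1..T}"
    using assms(1) by (auto simp: noisy_iterative_def)
  interpret prob_space ?M by fact
  have noise: "noise A t \<in> measurable ?M (Rd d)"
    using ind t by (simp add: indep_vars_def2)
  have indc: "indep_vars (\<lambda>_. borel) (\<lambda>i \<omega>. noise A t \<omega> i) {..<d}"
    and dist: "\<And>i. i < d \<Longrightarrow> distributed ?M lborel (\<lambda>\<omega>. noise A t \<omega> i) (\<lambda>x. ennreal (laplace_density 0 (\<sigma> t / sqrt 2) x))"
    using assms(2) t by (auto simp: laplace_noise_def)
  \<comment> \<open>The values of \<open>noise A t\<close> are extensional, so restricting the
    vector to \<open>{..<d}\<close> changes nothing.\<close>
  have "distr ?M (Rd d) (noise A t) = distr ?M (Rd d) (\<lambda>\<omega>. \<lambda>i\<in>{..<d}. noise A t \<omega> i)"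
    using measurable_space[OF noise]
    by (intro distr_cong) (auto simp: space_PiM PiE_iff extensional_restrict)
  also have "\<dots> = PiM {..<d} (\<lambda>i. distr ?M borel (\<lambda>\<omega>. noise A t \<omega> i))"
    by (rule indep_vars_distr_PiM[OF M indc])
  also have "\<dots> = PiM {..<d} (\<lambda>i. density lborel (\<lambda>x. ennreal (laplace_density 0 (\<sigma> t / sqrt 2) x)))"
  proof (rule PiM_cong)
    fix i assume "i \<in> {..<d}"
    then have "distr ?M lborel (\<lambda>\<omega>. noise A t \<omega> i) = density lborel (\<lambda>x. ennreal (laplace_density 0 (\<sigma> t / sqrt 2) x))"
      using dist by (intro distributed_distr_eq_density) auto
    then show "distr ?M borel (\<lambda>\<omega>. noise A t \<omega> i) = density lborel (\<lambda>x. ennreal (laplace_density 0 (\<sigma> t / sqrt 2) x))"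
      by (simp cong: distr_cong)
  qed simp
  also have "\<dots> = envelope_law (sqrt 2 / \<sigma> t) d 0"
    using PiM_laplace[of "\<sigma> t / sqrt 2" d] assms(4) by simp
  finally show ?thesis .
qed

text \<open>The joint law of the inputs is a product of the laws of the noises, of the initial
  point, and of data and batches together, since the last two may depend on each other. The path
  comparison is made for fixed initial point, data and batches; its right-hand side is free of the
  batches, which are then integrated out.\<close>

lemma leakage_le_trunc_exp:
  fixes A :: "('w, 'z, 'o) noisy_alg"
  assumes alg: "laplace_noisy_iterative d T L \<eta> \<sigma> A"
    and \<eta>: "\<And>t. t \<in> {1..T} \<Longrightarrow> \<eta> t > 0" and \<sigma>: "\<And>t. t \<in> {1..T} \<Longrightarrow> \<sigma> t > 0"
  shows "leakage T A \<le> ereal (\<Sum>t=1..T. ln (trunc_exp (sqrt 2 / \<sigma> t) d (\<eta> t * L)))"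
proof -
  let ?M = "prob_of A" and ?D = "data_space A" and ?Z = "batches_space A T" and ?O = "out_space A"
  let ?W = "iterate A 0" and ?R = "traj_space d T"
  have ni: "noisy_iterative d T \<eta> A" and bd: "bounded_direction d L A" and ln: "laplace_noise d T \<sigma> A"
    using alg by (auto simp: laplace_noisy_iterative_def)
  have M: "prob_space ?M"
    and drift [measurable]: "drift A \<in> measurable (Rd d) (Rd d)"
    and dir: "(\<lambda>(w, z). direction A w z) \<in> measurable (Rd d \<Otimes>\<^sub>M batch_space A) (Rd d)"
    and out [measurable]: "out_fun A \<in> measurable ?R ?O"
    and indW: "indep_rvs ?M (Rd d) ?W (?D \<Otimes>\<^sub>M ?Z) (\<lambda>\<omega>. (data A \<omega>, batches A T \<omega>))"
    and indN: "prob_space.indep_vars ?M (\<lambda>_. Rd d) (noise A) {1..T}"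
    and indU: "indep_rvs ?M ?R (noises A T) (Rd d \<Otimes>\<^sub>M ?D \<Otimes>\<^sub>M ?Z) (\<lambda>\<omega>. (?W \<omega>, data A \<omega>, batches A T \<omega>))"
    using ni by (auto simp: noisy_iterative_def)
  interpret prob_space ?M by (rule M)
  have W [measurable]: "?W \<in> measurable ?M (Rd d)"
    and DZ: "(\<lambda>\<omega>. (data A \<omega>, batches A T \<omega>)) \<in> measurable ?M (?D \<Otimes>\<^sub>M ?Z)"
    and U: "(\<lambda>\<omega>. (?W \<omega>, data A \<omega>, batches A T \<omega>)) \<in> measurable ?M (Rd d \<Otimes>\<^sub>M ?D \<Otimes>\<^sub>M ?Z)"
    and N [measurable]: "noises A T \<in> measurable ?M ?R"
    using indW indU by (auto simp: indep_rvs_def)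
  have X [measurable]: "data A \<in> measurable ?M ?D" and Z [measurable]: "batches A T \<in> measurable ?M ?Z"
    using measurable_compose[OF DZ measurable_fst] measurable_compose[OF DZ measurable_snd] by simp_all

  \<comment> \<open>The value 1 outside \<open>{1..T}\<close> makes \<open>c\<close> positive at
    every index, as the family of envelope laws must consist of probability measures
    throughout.\<close>
  define c where "c s = (if s \<in> {1..T} then sqrt 2 / \<sigma> s else 1)" for s
  define r where "r s = \<eta> s * L" for s
  define a where "a = drift_step d \<eta> A"
  \<comment> \<open>The reference drift omits the direction, and with it every dependence on the
    data.\<close>
  define b where "b = (\<lambda>s :: nat. drift A)"
  \<comment> \<open>The compared paths start at time 0, whereas the output function reads the times
    1 to \<open>T\<close>.\<close>
  define out' where "out' \<tau> = out_fun A (restrict \<tau> {1..T})" for \<tau>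
  define K where "K = (\<Prod>s=1..T. trunc_exp (c s) d (r s))"
  have c: "c s > 0" for s using \<sigma> by (simp add: c_def)
  have K: "K > 0" unfolding K_def by (intro prod_pos trunc_exp_pos c ballI)

  let ?P\<xi> = "PiM {1..T} (\<lambda>s. envelope_law (c s) d 0)"
  let ?Q\<xi> = "PiM {1..T} (\<lambda>s. envelope_law (c s) d (r s))"
  let ?PW = "distr ?M (Rd d) ?W" and ?PDZ = "distr ?M (?D \<Otimes>\<^sub>M ?Z) (\<lambda>\<omega>. (data A \<omega>, batches A T \<omega>))"
  let ?PD = "distr ?M ?D (data A)"
  interpret P: prob_space ?P\<xi> by (intro prob_space_PiM prob_space_envelope_law c)
  interpret Q: prob_space ?Q\<xi> by (intro prob_space_PiM prob_space_envelope_law c)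
  interpret PW: prob_space ?PW by (rule prob_space_distr) simp
  interpret PDZ: prob_space ?PDZ by (rule prob_space_distr[OF DZ])
  interpret PD: prob_space ?PD by (rule prob_space_distr) simp
  interpret U: pair_prob_space ?PW ?PDZ ..
  interpret PU: pair_sigma_finite ?P\<xi> "?PW \<Otimes>\<^sub>M ?PDZ" ..
  interpret WD: pair_sigma_finite ?PW ?PD ..
  interpret WQ: pair_prob_space ?PW ?Q\<xi> ..
  have sets_traj [measurable_cong]: "sets ?P\<xi> = sets ?R" "sets ?Q\<xi> = sets ?R"
    by (auto intro!: sets_PiM_cong)

  have law_noises: "distr ?M ?R (noises A T) = ?P\<xi>"
  proof -
    have "distr ?M ?R (noises A T) = distr ?M ?R (\<lambda>\<omega>. \<lambda>s\<in>{1..T}. noise A s \<omega>)"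
      by (simp add: noises_def[abs_def])
    also have "\<dots> = PiM {1..T} (\<lambda>s. distr ?M (Rd d) (noise A s))"
      by (rule indep_vars_distr_PiM[OF M indN])
    also have "\<dots> = ?P\<xi>"
      by (intro PiM_cong) (auto simp: c_def distr_noise[OF ni ln] \<sigma>)
    finally show ?thesis .
  qed
  have law: "distr ?M (?R \<Otimes>\<^sub>M Rd d \<Otimes>\<^sub>M ?D \<Otimes>\<^sub>M ?Z) (\<lambda>\<omega>. (noises A T \<omega>, ?W \<omega>, data A \<omega>, batches A T \<omega>))
      = ?P\<xi> \<Otimes>\<^sub>M ?PW \<Otimes>\<^sub>M ?PDZ"
    using indep_rvs_distr_eq[OF M indU] indep_rvs_distr_eq[OF M indW] law_noises by simp

  have out'_measurable [measurable]: "out' \<in> measurable (PiM {..T} (\<lambda>_. Rd d)) ?O"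
    unfolding out'_def[abs_def]
    by (rule measurable_compose[OF measurable_restrict_subset out]) auto
  have pa [measurable]: "(\<lambda>(\<xi>, w, s, z). \<lambda>t\<in>{..T}. noisy_path d (a z) w \<xi> t)
      \<in> measurable (?R \<Otimes>\<^sub>M Rd d \<Otimes>\<^sub>M ?D \<Otimes>\<^sub>M ?Z) (PiM {..T} (\<lambda>_. Rd d))"
    unfolding case_prod_beta
  proof (rule measurable_restrict, rule measurable_noisy_path)
    fix s assume s: "s \<in> {1..T}"
    let ?N = "(?R \<Otimes>\<^sub>M Rd d \<Otimes>\<^sub>M ?D \<Otimes>\<^sub>M ?Z) \<Otimes>\<^sub>M Rd d"
    have z: "(\<lambda>x. snd (snd (snd (fst x))) s) \<in> measurable ?N (batch_space A)"
      using s by measurable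
    have [measurable]: "(\<lambda>x. direction A (snd x) (snd (snd (snd (fst x))) s)) \<in> measurable ?N (Rd d)"
      using measurable_compose[OF measurable_Pair[OF measurable_snd z] dir] by simp
    show "(\<lambda>(x, v). a (snd (snd (snd x))) s v) \<in> measurable ?N (Rd d)"
      unfolding a_def drift_step_def case_prod_beta by measurable
    show "(\<lambda>x. fst x s) \<in> measurable (?R \<Otimes>\<^sub>M Rd d \<Otimes>\<^sub>M ?D \<Otimes>\<^sub>M ?Z) (Rd d)"
      using s by measurable
  qed auto
  have pb [measurable]: "(\<lambda>(w, \<xi>). \<lambda>t\<in>{..T}. noisy_path d b w \<xi> t)
      \<in> measurable (Rd d \<Otimes>\<^sub>M ?R) (PiM {..T} (\<lambda>_. Rd d))"
    unfolding case_prod_beta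
  proof (rule measurable_restrict, rule measurable_noisy_path)
    fix s assume s: "s \<in> {1..T}"
    show "(\<lambda>(x, v). b s v) \<in> measurable ((Rd d \<Otimes>\<^sub>M ?R) \<Otimes>\<^sub>M Rd d) (Rd d)"
      unfolding b_def by measurable
    show "(\<lambda>x. snd x s) \<in> measurable (Rd d \<Otimes>\<^sub>M ?R) (Rd d)"
      using s by measurable
  qed auto

  \<comment> \<open>The candidate for the leakage: the output law of the reference process with
    enlarged noise and the true initial law.\<close>
  define Q where "Q = distr (?PW \<Otimes>\<^sub>M ?Q\<xi>) ?O (\<lambda>(w, \<xi>). out' (\<lambda>t\<in>{..T}. noisy_path d b w \<xi> t))"
  have Qm: "(\<lambda>(w, \<xi>). out' (\<lambda>t\<in>{..T}. noisy_path d b w \<xi> t)) \<in> measurable (Rd d \<Otimes>\<^sub>M ?R) ?O"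
    using measurable_compose[OF pb out'_measurable] by (simp add: case_prod_beta)
  then have Qm': "(\<lambda>(w, \<xi>). out' (\<lambda>t\<in>{..T}. noisy_path d b w \<xi> t)) \<in> measurable (?PW \<Otimes>\<^sub>M ?Q\<xi>) ?O"
    by measurable
  have Q: "prob_space Q" unfolding Q_def by (rule WQ.prob_space_distr[OF Qm'])
  have setsQ: "sets Q = sets ?O" by (simp add: Q_def)
  interpret Q': prob_space Q by (rule Q)

  have final: "final_output A T \<omega> = out' (\<lambda>t\<in>{..T}. noisy_path d (a (batches A T \<omega>)) (?W \<omega>) (noises A T \<omega>) t)"
    if "\<omega> \<in> space ?M" for \<omega>
    unfolding final_output_def out'_def iterates_def a_def
    by (rule arg_cong[of _ _ "out_fun A"], rule ext)
      (simp add: iterate_eq_noisy_path[OF ni that, symmetric] restrict_def)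
  have Y [measurable]: "final_output A T \<in> measurable ?M ?O"
  proof -
    have "(\<lambda>\<omega>. (noises A T \<omega>, ?W \<omega>, data A \<omega>, batches A T \<omega>)) \<in> measurable ?M (?R \<Otimes>\<^sub>M Rd d \<Otimes>\<^sub>M ?D \<Otimes>\<^sub>M ?Z)"
      by measurable
    from measurable_compose[OF measurable_compose[OF this pa] out'_measurable]
    show ?thesis by (subst measurable_cong[OF final]) auto
  qed

  have "max_leakage ?M ?D (data A) ?O (final_output A T) \<le> ereal (ln K)"
  proof (rule max_leakage_le[OF M X Q setsQ K])
    fix C assume C [measurable]: "C \<in> sets (?D \<Otimes>\<^sub>M ?O)"
    define F :: "(nat \<Rightarrow> nat \<Rightarrow> real) \<times> (nat \<Rightarrow> real) \<times> (nat \<Rightarrow> 'z) \<times> (nat \<Rightarrow> 'z multiset) \<Rightarrow> ennreal"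
      where "F = (\<lambda>(\<xi>, w, s, z). indicator C (s, out' (\<lambda>t\<in>{..T}. noisy_path d (a z) w \<xi> t)))"
    \<comment> \<open>For data \<open>s\<close> and initial point \<open>w\<close>, this is the
      probability that the reference output completes \<open>s\<close> to a point of
      \<open>C\<close>.\<close>
    define G :: "(nat \<Rightarrow> 'z) \<Rightarrow> (nat \<Rightarrow> real) \<Rightarrow> ennreal"
      where "G s w = (\<integral>\<^sup>+\<xi>. indicator C (s, out' (\<lambda>t\<in>{..T}. noisy_path d b w \<xi> t)) \<partial>?Q\<xi>)" for s w
    have F [measurable]: "F \<in> borel_measurable (?R \<Otimes>\<^sub>M Rd d \<Otimes>\<^sub>M ?D \<Otimes>\<^sub>M ?Z)"
      unfolding F_def case_prod_beta
      using measurable_compose[OF pa out'_measurable] unfolding case_prod_beta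
      by (intro measurable_compose[OF measurable_Pair borel_measurable_indicator[OF C]]) auto
    have G [measurable]: "(\<lambda>(s, w). G s w) \<in> borel_measurable (?D \<Otimes>\<^sub>M Rd d)"
    proof -
      have "(\<lambda>x. (snd (fst x), snd x)) \<in> measurable ((?D \<Otimes>\<^sub>M Rd d) \<Otimes>\<^sub>M ?R) (Rd d \<Otimes>\<^sub>M ?R)"
        by measurable
      from measurable_compose[OF this Qm]
      have "(\<lambda>((s, w), \<xi>). indicator C (s, out' (\<lambda>t\<in>{..T}. noisy_path d b w \<xi> t)) :: ennreal)
          \<in> borel_measurable ((?D \<Otimes>\<^sub>M Rd d) \<Otimes>\<^sub>M ?R)"
        unfolding case_prod_beta
        by (intro measurable_compose[OF measurable_Pair borel_measurable_indicator[OF C]]) auto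
      then have "(\<lambda>((s, w), \<xi>). indicator C (s, out' (\<lambda>t\<in>{..T}. noisy_path d b w \<xi> t)) :: ennreal)
          \<in> borel_measurable ((?D \<Otimes>\<^sub>M Rd d) \<Otimes>\<^sub>M ?Q\<xi>)"
        by measurable
      from Q.borel_measurable_nn_integral_fst[OF this]
      show ?thesis unfolding G_def by (simp add: case_prod_beta)
    qed
    have "emeasure (distr ?M (?D \<Otimes>\<^sub>M ?O) (\<lambda>\<omega>. (data A \<omega>, final_output A T \<omega>))) C
        = (\<integral>\<^sup>+x. indicator C x \<partial>distr ?M (?D \<Otimes>\<^sub>M ?O) (\<lambda>\<omega>. (data A \<omega>, final_output A T \<omega>)))"
      by (rule nn_integral_indicator[symmetric]) simp
    also have "\<dots> = (\<integral>\<^sup>+\<omega>. indicator C (data A \<omega>, final_output A T \<omega>) \<partial>?M)"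
      by (intro nn_integral_distr) measurable
    also have "\<dots> = (\<integral>\<^sup>+\<omega>. F (noises A T \<omega>, ?W \<omega>, data A \<omega>, batches A T \<omega>) \<partial>?M)"
      by (intro nn_integral_cong) (simp add: F_def final)
    also have "\<dots> = (\<integral>\<^sup>+x. F x \<partial>(?P\<xi> \<Otimes>\<^sub>M ?PW \<Otimes>\<^sub>M ?PDZ))"
      unfolding law[symmetric] by (intro nn_integral_distr[symmetric]) measurable
    also have "\<dots> = (\<integral>\<^sup>+u. \<integral>\<^sup>+\<xi>. F (\<xi>, u) \<partial>?P\<xi> \<partial>(?PW \<Otimes>\<^sub>M ?PDZ))"
      by (rule PU.nn_integral_snd[symmetric]) measurable
    also have "\<dots> \<le> (\<integral>\<^sup>+u. ennreal K * G (fst (snd u)) (fst u) \<partial>(?PW \<Otimes>\<^sub>M ?PDZ))"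
    proof (rule nn_integral_mono)
      fix u assume "u \<in> space (?PW \<Otimes>\<^sub>M ?PDZ)"
      then obtain w s z where u: "u = (w, s, z)" and w: "w \<in> space (Rd d)"
        and s: "s \<in> space ?D" and z: "z \<in> space ?Z"
        by (auto simp: space_pair_measure)
      have z': "z t \<in> space (batch_space A)" if "t \<in> {1..T}" for t
        using z that by (auto simp: space_PiM PiE_iff)
      have "(\<integral>\<^sup>+\<xi>. indicator C (s, out' (\<lambda>t\<in>{..T}. noisy_path d (a z) w \<xi> t)) \<partial>?P\<xi>)
          \<le> ennreal K * (\<integral>\<^sup>+\<xi>. indicator C (s, out' (\<lambda>t\<in>{..T}. noisy_path d b w \<xi> t)) \<partial>?Q\<xi>)"
        unfolding K_def
      proof (rule noisy_path_law_le[OF c _ _ _ w])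
        fix t assume t: "t \<in> {1..T}"
        have [measurable]: "(\<lambda>v. direction A v (z t)) \<in> measurable (Rd d) (Rd d)"
          using measurable_compose[OF measurable_Pair2'[OF z'[OF t]] dir] by simp
        show "a z t \<in> measurable (Rd d) (Rd d)"
          unfolding a_def drift_step_def[abs_def] by measurable
        show "b t \<in> measurable (Rd d) (Rd d)"
          unfolding b_def by measurable
        fix v assume v: "v \<in> space (Rd d)"
        \<comment> \<open>The common drift cancels, leaving the direction scaled by the
          step-size.\<close>
        have "norm1 d (\<lambda>i. b t v i - a z t v i) = \<eta> t * norm1 d (direction A v (z t))"
          using \<eta>[OF t] by (simp add: norm1_def a_def b_def drift_step_def abs_mult sum_distrib_left)
        also have "\<dots> \<le> r t"
          using bd v z'[OF t] \<eta>[OF t] unfolding r_def bounded_direction_def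
          by (intro mult_left_mono) auto
        finally show "norm1 d (\<lambda>i. b t v i - a z t v i) \<le> r t" .
      next
        show "(\<lambda>\<tau>. indicator C (s, out' \<tau>)) \<in> borel_measurable (PiM {..T} (\<lambda>_. Rd d))"
          using s by measurable
      qed
      then show "(\<integral>\<^sup>+\<xi>. F (\<xi>, u) \<partial>?P\<xi>) \<le> ennreal K * G (fst (snd u)) (fst u)"
        by (simp add: F_def G_def u)
    qed
    also have "\<dots> = ennreal K * (\<integral>\<^sup>+u. G (fst (snd u)) (fst u) \<partial>(?PW \<Otimes>\<^sub>M ?PDZ))"
      by (rule nn_integral_cmult) measurable
    also have "(\<integral>\<^sup>+u. G (fst (snd u)) (fst u) \<partial>(?PW \<Otimes>\<^sub>M ?PDZ))
        = (\<integral>\<^sup>+w. \<integral>\<^sup>+y. G (fst y) w \<partial>?PDZ \<partial>?PW)"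
      by (subst PDZ.nn_integral_fst[symmetric]) simp_all
    \<comment> \<open>Only the data component of \<open>y\<close> enters, so the batches integrate
      out to the marginal law of the data.\<close>
    also have "\<dots> = (\<integral>\<^sup>+w. \<integral>\<^sup>+s. G s w \<partial>?PD \<partial>?PW)"
    proof (rule nn_integral_cong)
      fix w assume "w \<in> space ?PW"
      then have [measurable]: "(\<lambda>s. G s w) \<in> borel_measurable ?D" by simp
      show "(\<integral>\<^sup>+y. G (fst y) w \<partial>?PDZ) = (\<integral>\<^sup>+s. G s w \<partial>?PD)"
        by (subst nn_integral_distr[OF DZ], measurable, subst nn_integral_distr[OF X]) simp_all
    qed
    \<comment> \<open>With the initial point integrated first, the inner integral becomes the
      \<open>Q\<close>-measure of a slice of \<open>C\<close>.\<close>
    also have "\<dots> = (\<integral>\<^sup>+s. \<integral>\<^sup>+w. G s w \<partial>?PW \<partial>?PD)"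
      by (rule WD.Fubini'[symmetric]) measurable
    also have "\<dots> = (\<integral>\<^sup>+s. \<integral>\<^sup>+y. indicator C (s, y) \<partial>Q \<partial>?PD)"
    proof (rule nn_integral_cong)
      fix s assume s: "s \<in> space ?PD"
      have [measurable]: "(\<lambda>y. indicator C (s, y) :: ennreal) \<in> borel_measurable ?O"
        using s by (intro measurable_compose[OF measurable_Pair1' borel_measurable_indicator[OF C]]) simp
      have "(\<integral>\<^sup>+y. indicator C (s, y) \<partial>Q)
          = (\<integral>\<^sup>+x. indicator C (s, (\<lambda>(w, \<xi>). out' (\<lambda>t\<in>{..T}. noisy_path d b w \<xi> t)) x) \<partial>(?PW \<Otimes>\<^sub>M ?Q\<xi>))"
        unfolding Q_def by (rule nn_integral_distr[OF Qm']) simp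
      also have "\<dots> = (\<integral>\<^sup>+w. G s w \<partial>?PW)"
        unfolding G_def using measurable_compose[OF Qm', of "\<lambda>y. indicator C (s, y) :: ennreal" borel]
        by (subst Q.nn_integral_fst[symmetric]) simp_all
      finally show "(\<integral>\<^sup>+w. G s w \<partial>?PW) = (\<integral>\<^sup>+y. indicator C (s, y) \<partial>Q)" ..
    qed
    also have "\<dots> = emeasure (?PD \<Otimes>\<^sub>M Q) C"
      by (subst Q'.emeasure_pair_measure) (simp_all add: setsQ cong: sets_pair_measure_cong)
    finally show "emeasure (distr ?M (?D \<Otimes>\<^sub>M ?O) (\<lambda>\<omega>. (data A \<omega>, final_output A T \<omega>))) C
      \<le> ennreal K * emeasure (?PD \<Otimes>\<^sub>M Q) C" .
  qed
  also have "ln K = (\<Sum>t=1..T. ln (trunc_exp (c t) d (r t)))"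
    unfolding K_def using trunc_exp_pos[OF c] by (intro ln_prod) (auto simp: less_imp_neq[symmetric])
  also have "\<dots> = (\<Sum>t=1..T. ln (trunc_exp (sqrt 2 / \<sigma> t) d (\<eta> t * L)))"
    by (intro sum.cong) (auto simp: c_def r_def)
  finally show ?thesis by (simp add: leakage_def)
qed

section \<open>Closed form of the bound and its limit in the dimension\<close>

text \<open>The volume term is the summand of index \<open>d\<close>, because
  \<open>2 * (\<eta> * L) / (\<sigma> * sqrt 2)\<close> equals
  \<open>sqrt 2 * \<eta> * L / \<sigma>\<close>.\<close>

lemma trunc_exp_eq:
  assumes "\<eta> > 0" "L > 0" "\<sigma> > 0"
  shows "trunc_exp (sqrt 2 / \<sigma>) d (\<eta> * L) =
    V1 d (\<eta> * L) / (\<sigma> * sqrt 2) ^ d + (\<Sum>i<d. (sqrt 2 * \<eta> * L / \<sigma>) ^ i / fact i)"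
proof -
  have "2 * (\<eta> * L) / (\<sigma> * sqrt 2) = sqrt 2 * \<eta> * L / \<sigma>"
    using assms by (simp add: field_simps)
  then have *: "(2 * (\<eta> * L)) ^ d / (\<sigma> * sqrt 2) ^ d = (sqrt 2 * \<eta> * L / \<sigma>) ^ d"
    by (metis power_divide)
  have "V1 d (\<eta> * L) / (\<sigma> * sqrt 2) ^ d = (2 * (\<eta> * L)) ^ d / (\<sigma> * sqrt 2) ^ d / fact d"
    by (simp add: V1_def)
  then have "V1 d (\<eta> * L) / (\<sigma> * sqrt 2) ^ d = (sqrt 2 * \<eta> * L / \<sigma>) ^ d / fact d"
    unfolding * .
  moreover have "\<not> \<eta> * L < 0" using assms by (simp add: not_less)
  ultimately show ?thesis
    by (simp add: trunc_exp_def lessThan_Suc_atMost[symmetric] mult.assoc)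
qed

text \<open>For \<open>r \<ge> 0\<close> the exponential series has nonnegative terms, so it
  dominates its partial sums; for negative \<open>r\<close> both sides coincide.\<close>

lemma trunc_exp_le_exp: "c > 0 \<Longrightarrow> trunc_exp c d r \<le> exp (c * r)"
proof (cases "r < 0")
  case False
  assume "c > 0"
  with False have "(\<Sum>i<Suc d. (c * r) ^ i / fact i) \<le> (\<Sum>i. (c * r) ^ i / fact i)"
    using summable_exp_generic[of "c * r"]
    by (intro sum_le_suminf) (auto simp: field_simps scaleR_conv_of_real)
  then show ?thesis
    using False by (simp add: trunc_exp_def exp_def lessThan_Suc_atMost field_simps scaleR_conv_of_real)
qed (simp add: trunc_exp_def)

theorem theorem8:
  fixes T :: nat and L :: real and \<eta> \<sigma> :: "nat \<Rightarrow> real"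
  assumes "L > 0"
    and "\<forall>t\<in>{1..T}. \<eta> t > 0"
    and "\<forall>t\<in>{1..T}. \<sigma> t > 0"
  shows "(\<forall>d (A :: ('w, 'z, 'o) noisy_alg).
            laplace_noisy_iterative d T L \<eta> \<sigma> A \<longrightarrow>
            leakage T A \<le> ereal (\<Sum>t=1..T.
              ln (V1 d (\<eta> t * L) / (\<sigma> t * sqrt 2) ^ d
                  + (\<Sum>i<d. (sqrt 2 * \<eta> t * L / \<sigma> t) ^ i / fact i))))
       \<and> (\<forall>A :: nat \<Rightarrow> ('w, 'z, 'o) noisy_alg.
            (\<forall>d\<ge>1. laplace_noisy_iterative d T L \<eta> \<sigma> (A d)) \<longrightarrow>
            limsup (\<lambda>d. leakage T (A d)) \<le> ereal (\<Sum>t=1..T. sqrt 2 * \<eta> t * L / \<sigma> t))"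
proof (intro conjI allI impI)
  fix d and A :: "('w, 'z, 'o) noisy_alg"
  assume "laplace_noisy_iterative d T L \<eta> \<sigma> A"
  then have "leakage T A \<le> ereal (\<Sum>t=1..T. ln (trunc_exp (sqrt 2 / \<sigma> t) d (\<eta> t * L)))"
    using assms by (intro leakage_le_trunc_exp) auto
  also have "(\<Sum>t=1..T. ln (trunc_exp (sqrt 2 / \<sigma> t) d (\<eta> t * L)))
      = (\<Sum>t=1..T. ln (V1 d (\<eta> t * L) / (\<sigma> t * sqrt 2) ^ d
          + (\<Sum>i<d. (sqrt 2 * \<eta> t * L / \<sigma> t) ^ i / fact i)))"
    using assms by (intro sum.cong) (auto simp: trunc_exp_eq)
  finally show "leakage T A \<le> ereal (\<Sum>t=1..T. ln (V1 d (\<eta> t * L) / (\<sigma> t * sqrt 2) ^ d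
          + (\<Sum>i<d. (sqrt 2 * \<eta> t * L / \<sigma> t) ^ i / fact i)))" .
next
  fix A :: "nat \<Rightarrow> ('w, 'z, 'o) noisy_alg"
  assume A: "\<forall>d\<ge>1. laplace_noisy_iterative d T L \<eta> \<sigma> (A d)"
  \<comment> \<open>The bound is uniform in \<open>d\<close>, so it passes to the upper
    limit.\<close>
  have "leakage T (A d) \<le> ereal (\<Sum>t=1..T. sqrt 2 * \<eta> t * L / \<sigma> t)" if "d \<ge> 1" for d
  proof -
    have "leakage T (A d) \<le> ereal (\<Sum>t=1..T. ln (trunc_exp (sqrt 2 / \<sigma> t) d (\<eta> t * L)))"
      using assms A that by (intro leakage_le_trunc_exp) auto
    also have "\<dots> \<le> ereal (\<Sum>t=1..T. sqrt 2 * \<eta> t * L / \<sigma> t)"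
    proof (unfold ereal_less_eq, rule sum_mono)
      fix t assume "t \<in> {1..T}"
      then have "sqrt 2 / \<sigma> t > 0" using assms by simp
      then have "ln (trunc_exp (sqrt 2 / \<sigma> t) d (\<eta> t * L)) \<le> sqrt 2 / \<sigma> t * (\<eta> t * L)"
        using trunc_exp_le_exp trunc_exp_pos by (metis ln_exp ln_mono exp_gt_zero)
      then show "ln (trunc_exp (sqrt 2 / \<sigma> t) d (\<eta> t * L)) \<le> sqrt 2 * \<eta> t * L / \<sigma> t"
        by (simp add: mult.assoc)
    qed
    finally show ?thesis .
  qed
  then show "limsup (\<lambda>d. leakage T (A d)) \<le> ereal (\<Sum>t=1..T. sqrt 2 * \<eta> t * L / \<sigma> t)"
    by (intro Limsup_bounded) (auto simp: eventually_sequentially)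
qed

end
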